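(* Let $H$ be an $r$-uniform hypergraph and assume that there is $\varepsilon>0$ such that $\mathrm{ex}(n,H)\ge \varepsilon n^{r-1/m_r(H)+\varepsilon}$ for all $n$. Then there exist a constant $C$ depending only on $\varepsilon$ and $H$ and an infinite sequence of positive integers $n$ for which \[ |\mathcal{F}_n(H)| \le 2^{C\cdot \mathrm{ex}(n,H)}. \]
   Context: For an $r$-uniform hypergraph $H$, $\mathrm{ex}(n,H)$ is the maximum number of edges in an $n$-vertex $H$-free $r$-uniform hypergraph, and $\mathcal{F}_n(H)$ is the set of all labeled $H$-free $r$-uniform hypergraphs on vertex set $[n]$. The $r$-density is $m_r(H)=\max\{\frac{e_F-1}{v_F-r} : F\subseteq H,\ v_F>r\}$, where $v_F,e_F$ are the numbers of vertices and edges of $F$. *)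

theory Defs
  imports Complex_Main "HOL-Library.Ramsey"
begin

text \<open>A hypergraph is a pair of a vertex set and an edge set.\<close>

type_synonym 'a hypergraph = "'a set \<times> 'a set set"

abbreviation verts :: "'a hypergraph \<Rightarrow> 'a set" where
  "verts \<equiv> fst"

abbreviation edges :: "'a hypergraph \<Rightarrow> 'a set set" where
  "edges \<equiv> snd"

definition uniform :: "nat \<Rightarrow> 'a hypergraph \<Rightarrow> bool" where
  "uniform r H \<longleftrightarrow> finite (verts H) \<and> edges H \<subseteq> nsets (verts H) r"

text \<open>Subhypergraphs need be neither induced nor spanning.\<close>

definition subhypergraph :: "'a hypergraph \<Rightarrow> 'a hypergraph \<Rightarrow> bool" where
  "subhypergraph F H \<longleftrightarrow>
     verts F \<subseteq> verts H \<and> edges F \<subseteq> edges H \<and> (\<forall>e\<in>edges F. e \<subseteq> verts F)"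

definition isomorphic :: "'a hypergraph \<Rightarrow> 'b hypergraph \<Rightarrow> bool" where
  "isomorphic H K \<longleftrightarrow>
     (\<exists>f. bij_betw f (verts H) (verts K) \<and> edges K = (\<lambda>e. f ` e) ` edges H)"

definition free :: "'a hypergraph \<Rightarrow> 'b hypergraph \<Rightarrow> bool" where
  "free H G \<longleftrightarrow> \<not> (\<exists>F. subhypergraph F G \<and> isomorphic H F)"

text \<open>
  Since hypergraphs are finite, it is enough to let the host hypergraphs have natural numbers
  as vertices. The uniformity \<open>r\<close> is an explicit argument because an edgeless \<open>H\<close> does not
  determine it. An edgeless \<open>H\<close> is also the only case in which the set below can be empty
  (and its maximum unspecified). For \<open>n < r\<close> an \<open>n\<close>-vertex hypergraph has no edges, so a bound
  \<open>ex r n H \<ge> \<epsilon> * n powr a\<close> with \<open>\<epsilon> > 0\<close> fails at \<open>n = 1\<close> when \<open>r \<ge> 2\<close> and can only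
  be asked for large \<open>n\<close>.
\<close>

definition ex :: "nat \<Rightarrow> nat \<Rightarrow> 'a hypergraph \<Rightarrow> nat" where
  "ex r n H =
     Max {card (edges G) | G :: nat hypergraph.
            uniform r G \<and> card (verts G) = n \<and> free H G}"

definition free_graphs :: "nat \<Rightarrow> nat \<Rightarrow> 'a hypergraph \<Rightarrow> nat hypergraph set" where
  "free_graphs r n H = {G. uniform r G \<and> verts G = {1..n} \<and> free H G}"

text \<open>
  If \<open>H\<close> has at least two edges, this is a maximum over a nonempty finite set and it is
  positive. If \<open>H\<close> has at most \<open>r\<close> vertices, it is unspecified.
\<close>

definition density :: "nat \<Rightarrow> 'a hypergraph \<Rightarrow> real" where
  "density r H =
     Max {(real (card (edges F)) - 1) / (real (card (verts F)) - real r) | F.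
            subhypergraph F H \<and> card (verts F) > r}"

end

theory Submission
  imports Defs "HOL-Library.Disjoint_Sets"
begin

text \<open>
  Let \<open>\<beta>\<close> be slightly larger than \<open>r - 1 / density r H\<close>. As \<open>ex r n H / n powr \<beta>\<close> tends to infinity, it
  attains a new maximum infinitely often, and for such \<open>n\<close> the values \<open>ex r m H\<close> with \<open>m \<le> n\<close> are
  at most \<open>(m / n) powr \<beta> * ex r n H\<close>. Sampling random \<open>m\<close>-subsets of the vertices of a graph with
  \<open>t * ex r n H\<close> edges, \<open>t\<close> large, and picking edge-disjoint copies of \<open>H\<close> inside them gives a weighted
  hypergraph of copies whose degrees are so balanced that the container method applies: all
  \<open>H\<close>-free subgraphs are covered by few sets that are smaller by a constant factor, where the
  logarithm of their number is of order \<open>t powr (- \<theta>) * ex r n H\<close> with \<open>\<theta> > 0\<close>. Iterating from the complete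
  hypergraph until \<open>t\<close> is bounded, the costs sum to \<open>O(ex r n H)\<close>.
\<close>

section \<open>Weighted hypergraph containers\<close>

text \<open>The obstacle is that \<open>ex r m H\<close> may be irregular in \<open>m\<close>,
  whereas supersaturation by sampling \<open>m\<close>-sets needs an upper bound on
  \<open>ex r m H\<close> in terms of \<open>ex r n H\<close>. A record of
  \<open>ex r n H / n powr \<beta>\<close> gives it for all smaller \<open>m\<close> at once, which
  is why the result is obtained for infinitely many \<open>n\<close> only. Let
  \<open>\<mu> = 1 / density r H\<close> and \<open>\<gamma> = r - \<beta>\<close>. With
  \<open>t * ex r n H\<close> edges the sampling ratio \<open>p\<close> can be of order
  \<open>t powr (- 1 / \<gamma>)\<close>, and the weighted copies are balanced with parameter
  \<open>\<tau> = p powr \<mu>\<close>. A fingerprint then has about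
  \<open>\<tau> * t * ex r n H\<close> edges, that is
  \<open>t powr (1 - \<mu> / \<gamma>) * ex r n H\<close>. For \<open>\<gamma> = \<mu>\<close> the
  power of \<open>t\<close> would disappear: every step would cost at least order
  \<open>ex r n H\<close>, while the number of steps is logarithmic in the initial \<open>t\<close>,
  which may grow with \<open>n\<close>. The surplus \<epsilon> in the hypothesis allows
  \<open>\<gamma> < \<mu>\<close>; the negative exponent pays both for the logarithm in the count of
  fingerprints and for the number of steps.\<close>

definition wdeg :: "'v set \<Rightarrow> nat \<Rightarrow> ('v set \<Rightarrow> real) \<Rightarrow> 'v set \<Rightarrow> real" where
  "wdeg V i w J = (\<Sum>g\<in>{g \<in> nsets V i. J \<subseteq> g}. w g)"

text \<open>For nonnegative weights \<open>\<le> 0\<close> means zero; as an inequality the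
  condition passes directly to sums of weights, as needed for \<open>add_link\<close>.\<close>

definition independent_sets :: "'v set \<Rightarrow> nat \<Rightarrow> ('v set \<Rightarrow> real) \<Rightarrow> 'v set set" where
  "independent_sets V i w = {I. I \<subseteq> V \<and> (\<forall>g \<in> nsets I i. w g \<le> 0)}"

definition covered :: "'v set set \<Rightarrow> nat \<Rightarrow> real \<Rightarrow> bool" where
  "covered \<I> M x \<longleftrightarrow>
     (\<exists>\<C>. finite \<C> \<and> card \<C> \<le> M \<and> (\<forall>C\<in>\<C>. finite C \<and> real (card C) \<le> x) \<and> (\<forall>I\<in>\<I>. \<exists>C\<in>\<C>. I \<subseteq> C))"

definition binomial_sum :: "nat \<Rightarrow> nat \<Rightarrow> nat" where
  "binomial_sum u q = (\<Sum>k\<le>q. u choose k)"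

text \<open>The codegree condition of the container method, scaled so that vertex degrees are at
  most 1. Fingerprints will use about a proportion \<tau> of the vertices.\<close>

definition balanced :: "'v set \<Rightarrow> nat \<Rightarrow> real \<Rightarrow> ('v set \<Rightarrow> real) \<Rightarrow> bool" where
  "balanced V i \<tau> w \<longleftrightarrow>
     (\<forall>g. 0 \<le> w g) \<and> (\<forall>J. J \<subseteq> V \<longrightarrow> J \<noteq> {} \<longrightarrow> wdeg V i w J \<le> \<tau> ^ (card J - 1))"

lemma covered_mono:
  assumes "covered \<I> M x" "\<J> \<subseteq> \<I>" "M \<le> N" "x \<le> y"
  shows "covered \<J> N y"
  using assms unfolding covered_def by (meson order_trans subsetD)

lemma covered_Un:
  assumes "covered \<I> M x" "covered \<J> N x"
  shows "covered (\<I> \<union> \<J>) (M + N) x"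
proof -
  obtain A where A: "finite A" "card A \<le> M" "\<forall>C\<in>A. finite C \<and> real (card C) \<le> x" "\<forall>I\<in>\<I>. \<exists>C\<in>A. I \<subseteq> C"
    using assms(1) unfolding covered_def by blast
  obtain B where B: "finite B" "card B \<le> N" "\<forall>C\<in>B. finite C \<and> real (card C) \<le> x" "\<forall>I\<in>\<J>. \<exists>C\<in>B. I \<subseteq> C"
    using assms(2) unfolding covered_def by blast
  have "card (A \<union> B) \<le> M + N"
    using A(2) B(2) card_Un_le[of A B] by linarith
  moreover have "\<forall>I\<in>\<I> \<union> \<J>. \<exists>C\<in>A \<union> B. I \<subseteq> C" using A(4) B(4) by blast
  ultimately show ?thesis
    unfolding covered_def using A B by (intro exI[of _ "A \<union> B"]) auto
qed

lemma covered_single: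
  assumes "finite C" "real (card C) \<le> x" "\<And>I. I \<in> \<I> \<Longrightarrow> I \<subseteq> C"
  shows "covered \<I> 1 x"
  unfolding covered_def using assms by (intro exI[of _ "{C}"]) auto

lemma binomial_sum_Suc_Suc:
  "binomial_sum (Suc u) (Suc q) = binomial_sum u (Suc q) + binomial_sum u q"
  unfolding binomial_sum_def by (simp add: sum.atMost_Suc_shift sum.distrib del: sum.atMost_Suc)

lemma binomial_sum_ge_1: "1 \<le> binomial_sum u q"
  unfolding binomial_sum_def by (simp add: sum.atMost_shift)

lemma wdeg_empty: "wdeg V i w {} = (\<Sum>g\<in>nsets V i. w g)"
  by (simp add: wdeg_def)

lemma wdeg_nonneg:
  assumes "\<And>g. 0 \<le> w g"
  shows "0 \<le> wdeg V i w J"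
  unfolding wdeg_def by (simp add: assms sum_nonneg)

lemma sum_wdeg_Pow:
  assumes "finite V"
  shows "(\<Sum>J\<in>Pow V. wdeg V i w J) = 2 ^ i * (\<Sum>g\<in>nsets V i. w g)"
proof -
  have fin: "finite (nsets V i)" by (simp add: assms finite_imp_finite_nsets)
  have "(\<Sum>J\<in>Pow V. wdeg V i w J) = (\<Sum>J\<in>Pow V. \<Sum>g\<in>nsets V i. if J \<subseteq> g then w g else 0)"
    unfolding wdeg_def using fin by (simp add: sum.inter_filter)
  also have "\<dots> = (\<Sum>g\<in>nsets V i. \<Sum>J\<in>Pow V. if J \<subseteq> g then w g else 0)"
    by (rule sum.swap)
  also have "\<dots> = (\<Sum>g\<in>nsets V i. 2 ^ i * w g)"
  proof (rule sum.cong)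
    fix g assume "g \<in> nsets V i"
    then have g: "g \<subseteq> V" "finite g" "card g = i" by (auto simp: nsets_def)
    have "{J \<in> Pow V. J \<subseteq> g} = Pow g" using g by auto
    then have "(\<Sum>J\<in>Pow V. if J \<subseteq> g then w g else 0) = (\<Sum>J\<in>Pow g. w g)"
      using assms by (simp add: sum.inter_filter[symmetric])
    then show "(\<Sum>J\<in>Pow V. if J \<subseteq> g then w g else 0) = 2 ^ i * w g"
      using g by (simp add: card_Pow)
  qed simp
  finally show ?thesis by (simp add: sum_distrib_left)
qed

lemma sum_wdeg_singleton:
  assumes "finite V"
  shows "(\<Sum>v\<in>V. wdeg V i w {v}) = real i * (\<Sum>g\<in>nsets V i. w g)"
proof -
  have fin: "finite (nsets V i)" by (simp add: assms finite_imp_finite_nsets)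
  have "(\<Sum>v\<in>V. wdeg V i w {v}) = (\<Sum>v\<in>V. \<Sum>g\<in>nsets V i. if v \<in> g then w g else 0)"
    unfolding wdeg_def using fin by (simp add: sum.inter_filter)
  also have "\<dots> = (\<Sum>g\<in>nsets V i. \<Sum>v\<in>V. if v \<in> g then w g else 0)"
    by (rule sum.swap)
  also have "\<dots> = (\<Sum>g\<in>nsets V i. real i * w g)"
  proof (rule sum.cong)
    fix g assume "g \<in> nsets V i"
    then have g: "g \<subseteq> V" "finite g" "card g = i" by (auto simp: nsets_def)
    have "{v \<in> V. v \<in> g} = g" using g by auto
    then have "(\<Sum>v\<in>V. if v \<in> g then w g else 0) = (\<Sum>v\<in>g. w g)"
      using assms by (simp add: sum.inter_filter[symmetric])
    then show "(\<Sum>v\<in>V. if v \<in> g then w g else 0) = real i * w g"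
      using g by simp
  qed simp
  finally show ?thesis by (simp add: sum_distrib_left)
qed

definition add_link :: "('v set \<Rightarrow> real) \<Rightarrow> 'v \<Rightarrow> ('v set \<Rightarrow> real) \<Rightarrow> 'v set \<Rightarrow> real" where
  "add_link R v N f = N f + (if v \<in> f then 0 else R (insert v f))"

lemma wdeg_add_link:
  assumes "finite V" "v \<in> V"
  shows "wdeg V i (add_link R v N) J =
    wdeg V i N J + (if v \<in> J then 0 else wdeg V (Suc i) R (insert v J))"
proof -
  have fin: "finite (nsets V i)" by (simp add: assms finite_imp_finite_nsets)
  have "wdeg V i (add_link R v N) J = wdeg V i N J +
     (\<Sum>f\<in>{f \<in> nsets V i. J \<subseteq> f}. if v \<in> f then 0 else R (insert v f))"
    unfolding wdeg_def add_link_def by (simp add: sum.distrib)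
  also have "(\<Sum>f\<in>{f \<in> nsets V i. J \<subseteq> f}. if v \<in> f then 0 else R (insert v f)) =
     (\<Sum>f\<in>{f \<in> nsets V i. J \<subseteq> f \<and> v \<notin> f}. R (insert v f))"
    using fin by (intro sum.mono_neutral_cong_right) auto
  also have "\<dots> = (if v \<in> J then 0 else wdeg V (Suc i) R (insert v J))"
  proof (cases "v \<in> J")
    case True
    then have "{f \<in> nsets V i. J \<subseteq> f \<and> v \<notin> f} = {}" by auto
    then have "(\<Sum>f\<in>{f \<in> nsets V i. J \<subseteq> f \<and> v \<notin> f}. R (insert v f)) = 0"
      by (simp only: sum.empty)
    then show ?thesis using True by simp
  next
    case False
    have "bij_betw (insert v) {f \<in> nsets V i. J \<subseteq> f \<and> v \<notin> f} {g \<in> nsets V (Suc i). insert v J \<subseteq> g}"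
    proof (rule bij_betw_byWitness[where f' = "\<lambda>g. g - {v}"])
      show "insert v ` {f \<in> nsets V i. J \<subseteq> f \<and> v \<notin> f} \<subseteq> {g \<in> nsets V (Suc i). insert v J \<subseteq> g}"
        using assms by (auto simp: nsets_def)
      show "(\<lambda>g. g - {v}) ` {g \<in> nsets V (Suc i). insert v J \<subseteq> g} \<subseteq> {f \<in> nsets V i. J \<subseteq> f \<and> v \<notin> f}"
        using assms False by (auto simp: nsets_def)
    qed auto
    then have "(\<Sum>f\<in>{f \<in> nsets V i. J \<subseteq> f \<and> v \<notin> f}. R (insert v f)) =
        (\<Sum>g\<in>{g \<in> nsets V (Suc i). insert v J \<subseteq> g}. R g)"
      by (rule sum.reindex_bij_betw)
    then show ?thesis using False by (simp add: wdeg_def)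
  qed
  finally show ?thesis .
qed

text \<open>The threshold is half of the bound \<open>2 * \<tau> ^ card J\<close> kept for
  \<open>N\<close> during the process: one query raises the degree of \<open>J\<close> by at most
  \<open>\<tau> ^ card J\<close>, and only while \<open>J\<close> is not yet saturated.\<close>

definition unsaturated :: "'v set \<Rightarrow> nat \<Rightarrow> real \<Rightarrow> ('v set \<Rightarrow> real) \<Rightarrow> ('v set \<Rightarrow> real) \<Rightarrow> 'v set \<Rightarrow> real" where
  "unsaturated V i \<tau> w N g =
     (if \<exists>J\<subseteq>g. J \<noteq> {} \<and> wdeg V i N J > \<tau> ^ card J then 0 else w g)"

lemma unsaturated_le:
  assumes "\<And>g. 0 \<le> w g"
  shows "unsaturated V i \<tau> w N g \<le> w g" "0 \<le> unsaturated V i \<tau> w N g"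
  using assms by (auto simp: unsaturated_def)

lemma wdeg_mono:
  assumes "\<And>g. w g \<le> w' g"
  shows "wdeg V i w J \<le> wdeg V i w' J"
  unfolding wdeg_def by (simp add: assms sum_mono)

text \<open>Every deleted edge contains a saturated \<open>J\<close>. The \<open>w\<close>-degree of
  such a \<open>J\<close> is at most \<open>\<tau> ^ (card J - 1)\<close>, hence below its
  \<open>N\<close>-degree divided by \<tau>. Summing the \<open>N\<close>-degrees over all
  \<open>J\<close> counts each edge of \<open>N\<close> once per subset, \<open>2 ^ i\<close>
  times.\<close>

lemma sum_unsaturated_ge:
  assumes "finite V" "0 < \<tau>" and w: "\<And>g. 0 \<le> w g" and N: "\<And>g. 0 \<le> N g"
    and deg: "\<And>J. J \<subseteq> V \<Longrightarrow> J \<noteq> {} \<Longrightarrow> wdeg V (Suc i) w J \<le> \<tau> ^ (card J - 1)"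
  shows "(\<Sum>g\<in>nsets V (Suc i). unsaturated V i \<tau> w N g) \<ge>
     (\<Sum>g\<in>nsets V (Suc i). w g) - 2 ^ i * (\<Sum>g\<in>nsets V i. N g) / \<tau>"
proof -
  define S where "S = {J \<in> Pow V. J \<noteq> {} \<and> wdeg V i N J > \<tau> ^ card J}"
  define K where "K = {g \<in> nsets V (Suc i). \<exists>J\<subseteq>g. J \<noteq> {} \<and> wdeg V i N J > \<tau> ^ card J}"
  have fin: "finite (nsets V (Suc i))" by (simp add: assms finite_imp_finite_nsets)
  have finS: "finite S" unfolding S_def using assms(1) by simp
  have "(\<Sum>g\<in>nsets V (Suc i). w g) - (\<Sum>g\<in>nsets V (Suc i). unsaturated V i \<tau> w N g)
     = (\<Sum>g\<in>nsets V (Suc i). w g - unsaturated V i \<tau> w N g)"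
    by (simp add: sum_subtractf)
  also have "\<dots> = (\<Sum>g\<in>K. w g)"
    unfolding K_def using fin by (intro sum.mono_neutral_cong_right) (auto simp: unsaturated_def)
  also have "\<dots> \<le> (\<Sum>g\<in>(\<Union>J\<in>S. {g \<in> nsets V (Suc i). J \<subseteq> g}). w g)"
  proof (rule sum_mono2)
    show "finite (\<Union>J\<in>S. {g \<in> nsets V (Suc i). J \<subseteq> g})" using finS fin by simp
    show "K \<subseteq> (\<Union>J\<in>S. {g \<in> nsets V (Suc i). J \<subseteq> g})"
      by (force simp: K_def S_def nsets_def)
  qed (rule w)
  also have "\<dots> \<le> (\<Sum>J\<in>S. wdeg V (Suc i) w J)"
    unfolding wdeg_def using finS
  proof (induction S rule: finite_induct)
    case (insert J S)
    have "(\<Sum>g\<in>(\<Union>J\<in>insert J S. {g \<in> nsets V (Suc i). J \<subseteq> g}). w g)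
      \<le> (\<Sum>g\<in>{g \<in> nsets V (Suc i). J \<subseteq> g}. w g) + (\<Sum>g\<in>(\<Union>J\<in>S. {g \<in> nsets V (Suc i). J \<subseteq> g}). w g)"
      using insert(1) fin w
      by (subst UN_insert, subst sum_Un) (auto intro!: sum_nonneg)
    then show ?case using insert by simp
  qed simp
  also have "\<dots> \<le> (\<Sum>J\<in>S. wdeg V i N J / \<tau>)"
  proof (rule sum_mono)
    fix J assume J: "J \<in> S"
    then have "finite J" using assms(1) by (auto simp: S_def intro: finite_subset)
    then have "card J > 0" using J by (simp add: S_def card_gt_0_iff)
    then have "\<tau> ^ card J = \<tau> * \<tau> ^ (card J - 1)" by (metis power_eq_if neq0_conv)
    then have "\<tau> ^ (card J - 1) \<le> wdeg V i N J / \<tau>"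
      using J assms(2) by (simp add: S_def field_simps)
    then show "wdeg V (Suc i) w J \<le> wdeg V i N J / \<tau>"
      using deg[of J] J unfolding S_def by auto
  qed
  also have "\<dots> \<le> (\<Sum>J\<in>Pow V. wdeg V i N J / \<tau>)"
    by (rule sum_mono2) (use assms wdeg_nonneg[of N] in \<open>auto simp: S_def\<close>)
  also have "\<dots> = 2 ^ i * (\<Sum>g\<in>nsets V i. N g) / \<tau>"
    by (simp add: sum_wdeg_Pow assms(1) flip: sum_divide_distrib)
  finally show ?thesis by linarith
qed

text \<open>
  Vertices are queried one at a time: \<open>U\<close> holds the vertices not yet queried, \<open>Y\<close> those found to
  lie in the independent set \<open>I\<close>, and \<open>q\<close> bounds the positive answers still to come. Only vertices
  of degree at least \<open>\<kappa>\<close> in the unsaturated part \<open>R\<close> of \<open>w\<close> are queried. A positive answer moves the link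
  of the vertex into the hypergraph \<open>N\<close> of lower uniformity, which \<open>I\<close> must avoid as well. Saturation
  keeps the degrees of \<open>N\<close> bounded. If \<open>N\<close> becomes heavy, it satisfies the hypotheses of the
  induction over the uniformity; if no vertex is left to query, the vertices of degree at least
  \<open>\<kappa>\<close> in \<open>R\<close> that are not in \<open>Y\<close> are missed by \<open>I\<close>, and they form a constant proportion of \<open>V\<close>. The two branches of a
  query match Pascal's rule for \<open>binomial_sum\<close>.
\<close>

lemma container_process:
  fixes V :: "'v set" and i :: nat and c \<tau> \<delta> :: real
  defines "\<kappa> \<equiv> c / 2 ^ (i + 3)"
  assumes V: "finite V" "V \<noteq> {}" and \<tau>: "0 < \<tau>" and c: "0 < c"
    and bal: "balanced V (Suc i) \<tau> w"
    and tot: "(\<Sum>g\<in>nsets V (Suc i). w g) \<ge> c * card V"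
    and IH: "\<And>w'. balanced V i \<tau> w' \<Longrightarrow>
       (\<Sum>g\<in>nsets V i. w' g) \<ge> \<kappa> / 2 * card V \<Longrightarrow>
       covered (independent_sets V i w') M ((1 - \<delta>) * card V)"
    and M: "1 \<le> M" and \<delta>: "\<delta> \<le> c / 8" and q0: "real q0 \<le> \<delta> * card V"
    and UY: "U \<subseteq> V" "Y \<subseteq> V"
    and N: "\<And>g. 0 \<le> N g"
    and Ndeg: "\<And>J. J \<subseteq> V \<Longrightarrow> J \<noteq> {} \<Longrightarrow> wdeg V i N J \<le> 2 * \<tau> ^ card J"
    and q: "(\<Sum>g\<in>nsets V i. N g) + \<kappa> * real q \<ge> \<kappa> * \<tau> * card V"
    and Yq: "card Y + q \<le> q0"
    and indep: "\<And>I. I \<in> independent_sets V (Suc i) w \<Longrightarrow> Y \<subseteq> I \<Longrightarrow> I \<in> independent_sets V i N"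
  shows "covered {I \<in> independent_sets V (Suc i) w. Y \<subseteq> I \<and> I \<subseteq> U \<union> Y}
           (binomial_sum (card U) q * M) ((1 - \<delta>) * card V)"
  using UY N Ndeg q Yq indep
proof (induction "card U" arbitrary: U Y N q rule: less_induct)
  case less
  have w: "\<And>g. 0 \<le> w g"
    and deg: "\<And>J. J \<subseteq> V \<Longrightarrow> J \<noteq> {} \<Longrightarrow> wdeg V (Suc i) w J \<le> \<tau> ^ (card J - 1)"
    using bal by (auto simp: balanced_def)
  define R where "R = unsaturated V i \<tau> w N"
  have e: "0 < real (card V)" using V by (simp add: card_gt_0_iff)
  have \<kappa>: "0 < \<kappa>" "\<kappa> \<le> c / 8" using c unfolding \<kappa>_def
    by (simp, simp add: power_add field_simps)
  have R: "R g \<le> w g" "0 \<le> R g" for g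
    unfolding R_def using unsaturated_le[of w] w by auto
  have L: "M \<le> binomial_sum u k * M" for u k
    using binomial_sum_ge_1[of u k] by simp
  have finU: "finite U" using less V by (meson finite_subset)
  show ?case
  proof (cases "(\<Sum>g\<in>nsets V i. N g) \<ge> \<kappa> * \<tau> * card V")
    case True
    \<comment> \<open>Dividing by \<open>2 * \<tau>\<close> turns the bound
      \<open>2 * \<tau> ^ card J\<close> into \<open>\<tau> ^ (card J - 1)\<close> and the heavy
      total \<open>\<kappa> * \<tau> * card V\<close> into
      \<open>\<kappa> / 2 * card V\<close>.\<close>
    define w' where "w' = (\<lambda>g. N g / (2 * \<tau>))"
    have wd: "wdeg V i w' J = wdeg V i N J / (2 * \<tau>)" for J
      unfolding w'_def wdeg_def by (simp add: sum_divide_distrib)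
    have "covered (independent_sets V i w') M ((1 - \<delta>) * card V)"
    proof (rule IH)
      have "0 \<le> w' g" for g using less.prems(3) \<tau> by (simp add: w'_def)
      moreover have "wdeg V i w' J \<le> \<tau> ^ (card J - 1)" if J: "J \<subseteq> V" "J \<noteq> {}" for J
      proof -
        have "card J > 0" using J V(1) by (simp add: card_gt_0_iff finite_subset)
        then have "\<tau> ^ card J = \<tau> * \<tau> ^ (card J - 1)" by (metis power_eq_if neq0_conv)
        then show ?thesis
          using less.prems(4)[OF J] \<tau> by (simp add: wd field_simps)
      qed
      ultimately show "balanced V i \<tau> w'" by (simp add: balanced_def)
    next
      have "(\<Sum>g\<in>nsets V i. w' g) = (\<Sum>g\<in>nsets V i. N g) / (2 * \<tau>)"
        unfolding w'_def by (simp add: sum_divide_distrib)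
      moreover have "\<kappa> * \<tau> * card V / (2 * \<tau>) \<le> (\<Sum>g\<in>nsets V i. N g) / (2 * \<tau>)"
        using True \<tau> by (intro divide_right_mono) auto
      ultimately show "(\<Sum>g\<in>nsets V i. w' g) \<ge> \<kappa> / 2 * card V"
        using \<tau> by simp
    qed
    then show ?thesis
    proof (rule covered_mono)
      show "{I \<in> independent_sets V (Suc i) w. Y \<subseteq> I \<and> I \<subseteq> U \<union> Y} \<subseteq> independent_sets V i w'"
      proof
        fix I assume "I \<in> {I \<in> independent_sets V (Suc i) w. Y \<subseteq> I \<and> I \<subseteq> U \<union> Y}"
        then have "I \<in> independent_sets V i N" using less.prems(7) by auto
        then show "I \<in> independent_sets V i w'"
          using \<tau> by (auto simp: independent_sets_def w'_def divide_le_0_iff)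
      qed
    qed (use L in auto)
  next
    case small: False
    show ?thesis
    proof (cases "\<exists>v\<in>U. wdeg V (Suc i) R {v} \<ge> \<kappa>")
      case False
      \<comment> \<open>Since \<open>U \<subseteq> D\<close>, the container is
        \<open>D \<union> Y\<close>. The degrees in \<open>R\<close> sum to at least
        \<open>7/8 * c * card V\<close>. Vertices in \<open>D\<close> contribute at most an eighth
        of \<open>c * card V\<close>, the others at most 1 each, so at least
        \<open>3/4 * c * card V\<close> vertices lie outside \<open>D\<close>, and \<open>Y\<close>
        takes back at most an eighth of \<open>c * card V\<close>.\<close>
      define D where "D = {v \<in> V. wdeg V (Suc i) R {v} < \<kappa>}"
      have "2 ^ i * (\<Sum>g\<in>nsets V i. N g) / \<tau> \<le> 2 ^ i * (\<kappa> * card V)"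
        using small \<tau> by (simp add: field_simps)
      \<comment> \<open>The power of two in \<kappa> is chosen here: saturation may destroy at most
        an eighth of the guaranteed weight.\<close>
      also have "\<dots> = c / 8 * card V" unfolding \<kappa>_def by (simp add: power_add)
      finally have Rtot: "(\<Sum>g\<in>nsets V (Suc i). R g) \<ge> c * card V - c / 8 * card V"
        using sum_unsaturated_ge[where i = i and \<tau> = \<tau> and w = w and N = N and V = V] V \<tau> w less.prems(3) deg tot
        unfolding R_def by force
      have "c * card V - c / 8 * card V \<le> real (Suc i) * (\<Sum>g\<in>nsets V (Suc i). R g)"
        using Rtot e R by (smt (verit) mult_le_cancel_right1 of_nat_0_le_iff of_nat_Suc sum_nonneg)
      also have "\<dots> = (\<Sum>v\<in>V. wdeg V (Suc i) R {v})"
        using V by (simp add: sum_wdeg_singleton)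
      also have "\<dots> = (\<Sum>v\<in>D. wdeg V (Suc i) R {v}) + (\<Sum>v\<in>V - D. wdeg V (Suc i) R {v})"
        using V by (metis (no_types, lifting) D_def add.commute mem_Collect_eq subsetI sum.subset_diff)
      also have "(\<Sum>v\<in>D. wdeg V (Suc i) R {v}) \<le> (\<Sum>v\<in>D. \<kappa>)"
        by (rule sum_mono) (auto simp: D_def)
      also have "(\<Sum>v\<in>V - D. wdeg V (Suc i) R {v}) \<le> (\<Sum>v\<in>V - D. 1)"
      proof (rule sum_mono)
        fix v assume "v \<in> V - D"
        then show "wdeg V (Suc i) R {v} \<le> 1"
          using deg[of "{v}"] wdeg_mono[of R w V "Suc i" "{v}"] R by simp
      qed
      finally have 1: "c * card V - c / 8 * card V \<le> \<kappa> * card D + card (V - D)"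
        by (simp add: mult.commute)
      have DV: "D \<subseteq> V" by (auto simp: D_def)
      have "card D \<le> card V" using DV V by (simp add: card_mono)
      then have "\<kappa> * card D \<le> c / 8 * card V"
        using \<kappa> by (intro mult_mono) auto
      moreover have "real (card (V - D)) = real (card V) - real (card D)"
        using DV V by (simp add: card_Diff_subset finite_subset card_mono of_nat_diff)
      ultimately have 2: "card D \<le> card V - 3 / 4 * c * card V"
        using 1 by simp
      have "real (card Y) \<le> \<delta> * card V" using less.prems(6) q0 by linarith
      also have "\<dots> \<le> c / 8 * card V" using \<delta> e by (simp add: mult_right_mono)
      finally have Y: "real (card Y) \<le> c / 8 * card V" .
      have "\<delta> * card V \<le> c / 8 * card V" using \<delta> e by (simp add: mult_right_mono)
      moreover have "0 < c * card V" using c e by simp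
      moreover have "real (card (D \<union> Y)) \<le> card D + card Y"
        using card_Un_le[of D Y] by linarith
      moreover have "(1 - \<delta>) * card V = card V - \<delta> * card V" by (simp add: left_diff_distrib)
      ultimately have size: "real (card (D \<union> Y)) \<le> (1 - \<delta>) * card V"
        using Y 2 by linarith
      have fin: "finite (D \<union> Y)" using DV less.prems(2) V(1) by (simp add: finite_subset)
      have sub: "U \<subseteq> D" using False less.prems(1) unfolding D_def by force
      have "covered {I \<in> independent_sets V (Suc i) w. Y \<subseteq> I \<and> I \<subseteq> U \<union> Y} 1 ((1 - \<delta>) * card V)"
        using sub by (intro covered_single[OF fin size]) blast
      then show ?thesis
        by (rule covered_mono) (use L[of "card U" q] M in auto)
    next
      case True
      then obtain v where v: "v \<in> U" "wdeg V (Suc i) R {v} \<ge> \<kappa>" by blast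
      have vV: "v \<in> V" using v less.prems by auto
      \<comment> \<open>Each positive answer adds at least \<kappa> to the weight of
        \<open>N\<close>, so once the budget \<open>q\<close> is exhausted \<open>N\<close> is
        heavy, which is the case already treated.\<close>
      have "q \<noteq> 0" using small less.prems(5) by (intro notI) simp
      then obtain k where k: "q = Suc k" using not0_implies_Suc by blast
      have cU: "card U = Suc (card (U - {v}))" using v finU by (metis card.remove)
      define N' where "N' = add_link R v N"
      have N'deg: "wdeg V i N' J = wdeg V i N J + (if v \<in> J then 0 else wdeg V (Suc i) R (insert v J))" for J
        unfolding N'_def using wdeg_add_link V(1) vV .
      have no: "covered {I \<in> independent_sets V (Suc i) w. Y \<subseteq> I \<and> I \<subseteq> (U - {v}) \<union> Y}
           (binomial_sum (card (U - {v})) q * M) ((1 - \<delta>) * card V)"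
      proof (rule less.hyps)
        show "card (U - {v}) < card U" using cU by simp
        show "U - {v} \<subseteq> V" using less.prems(1) by blast
      qed (fact less.prems)+
      have yes: "covered {I \<in> independent_sets V (Suc i) w. insert v Y \<subseteq> I \<and> I \<subseteq> (U - {v}) \<union> insert v Y}
           (binomial_sum (card (U - {v})) k * M) ((1 - \<delta>) * card V)"
      proof (rule less.hyps)
        show "card (U - {v}) < card U" using cU by simp
        show "U - {v} \<subseteq> V" "insert v Y \<subseteq> V" using less.prems(1,2) vV by auto
        show "0 \<le> N' g" for g unfolding N'_def add_link_def using R(2)[of "insert v g"] less.prems(3)[of g] by simp
        show "wdeg V i N' J \<le> 2 * \<tau> ^ card J" if J: "J \<subseteq> V" "J \<noteq> {}" for J
        proof (cases "v \<in> J \<or> wdeg V i N J > \<tau> ^ card J")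
          case True
          then have "v \<in> J \<or> wdeg V (Suc i) R (insert v J) = 0"
          proof (elim disj_forward)
            assume *: "wdeg V i N J > \<tau> ^ card J"
            have "R g = 0" if "insert v J \<subseteq> g" for g
              using that * J(2) unfolding R_def unsaturated_def by auto
            then show "wdeg V (Suc i) R (insert v J) = 0"
              unfolding wdeg_def by (intro sum.neutral) blast
          qed
          then show ?thesis using less.prems(4)[OF J] by (auto simp: N'deg)
        next
          case False
          have "finite J" using J V by (meson finite_subset)
          then have "wdeg V (Suc i) R (insert v J) \<le> \<tau> ^ card J"
            using deg[of "insert v J"] wdeg_mono[of R w V "Suc i" "insert v J", OF R(1)] J(1) False vV by simp
          then show ?thesis using False by (simp add: N'deg)
        qed
        have "(\<Sum>g\<in>nsets V i. N' g) = (\<Sum>g\<in>nsets V i. N g) + wdeg V (Suc i) R {v}"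
          using N'deg[of "{}"] by (simp add: wdeg_empty)
        then show "\<kappa> * \<tau> * card V \<le> (\<Sum>g\<in>nsets V i. N' g) + \<kappa> * real k"
          using v(2) less.prems(5) k by (simp add: algebra_simps)
        have "card (insert v Y) \<le> Suc (card Y)" by (rule card_insert_le_m1) auto
        then show "card (insert v Y) + k \<le> q0" using less.prems(6) k by linarith
        fix I assume I: "I \<in> independent_sets V (Suc i) w" "insert v Y \<subseteq> I"
        then have "I \<in> independent_sets V i N" using less.prems(7) by auto
        moreover have "(if v \<in> f then 0 else R (insert v f)) \<le> 0" if f: "f \<in> nsets I i" for f
        proof (cases "v \<in> f")
          case False
          then have "insert v f \<in> nsets I (Suc i)" using I f by (auto simp: nsets_def)
          then have "w (insert v f) \<le> 0" using I(1) by (auto simp: independent_sets_def)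
          then show ?thesis using R[of "insert v f"] by simp
        qed simp
        ultimately show "I \<in> independent_sets V i N'"
          unfolding independent_sets_def N'_def add_link_def using add_nonpos_nonpos by blast
      qed
      show ?thesis
      proof (rule covered_mono[OF covered_Un[OF no yes]])
        show "binomial_sum (card (U - {v})) q * M + binomial_sum (card (U - {v})) k * M
            \<le> binomial_sum (card U) q * M"
          by (simp add: cU k binomial_sum_Suc_Suc algebra_simps)
      qed (use v in auto)
    qed
  qed
qed

text \<open>Each of the \<open>i\<close> uniformities contributes at most one fingerprint of at most
  \<open>q\<close> vertices, which explains the exponent \<open>i\<close>. The proportion \<delta>
  depends on \<open>c\<close> and \<open>i\<close> alone, so that it stays fixed when containers are
  iterated.\<close>

lemma weighted_container:
  fixes c :: real
  assumes "0 < c"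
  shows "\<exists>\<delta>::real. 0 < \<delta> \<and> \<delta> < 1 \<and> (\<forall>(V :: 'v set) w (\<tau> :: real) q.
      finite V \<and> V \<noteq> {} \<and> 0 < \<tau> \<and> balanced V i \<tau> w \<and>
      c * card V \<le> (\<Sum>g\<in>nsets V i. w g) \<and> \<tau> * card V \<le> real q \<and> real q \<le> \<delta> * card V \<longrightarrow>
      covered (independent_sets V i w) (binomial_sum (card V) q ^ i) ((1 - \<delta>) * card V))"
  using assms
proof (induction i arbitrary: c)
  case 0
  show ?case
  proof (intro exI[of _ "1/2"] conjI allI impI)
    fix V :: "'v set" and w :: "'v set \<Rightarrow> real" and \<tau> :: real and q :: nat
    assume "finite V \<and> V \<noteq> {} \<and> 0 < \<tau> \<and> balanced V 0 \<tau> w \<and>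
      c * card V \<le> (\<Sum>g\<in>nsets V 0. w g) \<and> \<tau> * card V \<le> real q \<and> real q \<le> 1/2 * real (card V)"
    then have *: "0 < real (card V)" "c * card V \<le> (\<Sum>g\<in>nsets V 0. w g)"
      by (auto simp: card_gt_0_iff)
    then have "0 < c * card V" using 0 by simp
    moreover have nsets_0: "nsets X 0 = {{}}" for X :: "'v set" by (auto simp: nsets_def)
    ultimately have "0 < w {}" using * by simp
    \<comment> \<open>In uniformity 0 the whole weight sits on the empty set, which every set
      contains. Nothing is independent, and an empty family of containers suffices.\<close>
    then have "independent_sets V 0 w = {}"
      by (auto simp: independent_sets_def nsets_0)
    then show "covered (independent_sets V 0 w) (binomial_sum (card V) q ^ 0) ((1 - 1/2) * real (card V))"
      unfolding covered_def by (intro exI[of _ "{}"]) auto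
  qed auto
next
  case (Suc i)
  define \<kappa> where "\<kappa> = c / 2 ^ (i + 3)"
  have "\<kappa> / 2 > 0" using Suc by (simp add: \<kappa>_def)
  from Suc.IH[OF this] obtain d :: real where d': "0 < d \<and> d < 1 \<and> (\<forall>(V :: 'v set) w (\<tau> :: real) q.
      finite V \<and> V \<noteq> {} \<and> 0 < \<tau> \<and> balanced V i \<tau> w \<and>
      \<kappa> / 2 * card V \<le> (\<Sum>g\<in>nsets V i. w g) \<and> \<tau> * card V \<le> real q \<and> real q \<le> d * card V \<longrightarrow>
      covered (independent_sets V i w) (binomial_sum (card V) q ^ i) ((1 - d) * card V))" ..
  note d = conjunct1[OF d'] conjunct1[OF conjunct2[OF d']]
    and IH = conjunct2[OF conjunct2[OF d']]
  define \<delta> where "\<delta> = min d (c / 8)"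
  have \<delta>: "0 < \<delta>" "\<delta> \<le> d" "\<delta> \<le> c / 8" using d Suc.prems by (auto simp: \<delta>_def)
  show ?case
  proof (intro exI[of _ \<delta>] conjI allI impI)
    fix V :: "'v set" and w :: "'v set \<Rightarrow> real" and \<tau> :: real and q :: nat
    assume "finite V \<and> V \<noteq> {} \<and> 0 < \<tau> \<and> balanced V (Suc i) \<tau> w \<and>
      c * card V \<le> (\<Sum>g\<in>nsets V (Suc i). w g) \<and> \<tau> * card V \<le> real q \<and> real q \<le> \<delta> * card V"
    then have V: "finite V" "V \<noteq> {}" and \<tau>: "0 < \<tau>" and bal: "balanced V (Suc i) \<tau> w"
      and tot: "(\<Sum>g\<in>nsets V (Suc i). w g) \<ge> c * card V"
      and q: "\<tau> * card V \<le> real q" "real q \<le> \<delta> * card V" by blast+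
    have "\<delta> * card V \<le> d * card V" using \<delta> by (simp add: mult_right_mono)
    then have q': "real q \<le> d * card V" "(1 - d) * card V \<le> (1 - \<delta>) * card V"
      using q(2) by (auto simp: algebra_simps)
    have "covered {I \<in> independent_sets V (Suc i) w. {} \<subseteq> I \<and> I \<subseteq> V \<union> {}}
           (binomial_sum (card V) q * binomial_sum (card V) q ^ i) ((1 - \<delta>) * card V)"
    \<comment> \<open>The process starts with every vertex unqueried and \<open>N\<close> zero, so
      its invariant on \<open>q\<close> reduces to \<open>\<tau> * card V \<le> q\<close>.\<close>
    proof (rule container_process[where c = c and \<tau> = \<tau> and N = "\<lambda>_. 0" and q0 = q])
      fix w' assume w': "balanced V i \<tau> w'"
        "c / 2 ^ (i + 3) / 2 * real (card V) \<le> sum w' (nsets V i)"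
      have "covered (independent_sets V i w') (binomial_sum (card V) q ^ i) ((1 - d) * card V)"
        by (rule IH[rule_format]) (use V \<tau> w' q(1) q' in \<open>simp add: \<kappa>_def\<close>)
      then show "covered (independent_sets V i w') (binomial_sum (card V) q ^ i) ((1 - \<delta>) * card V)"
        by (rule covered_mono) (use q'(2) in auto)
    next
      show "c / 2 ^ (i + 3) * \<tau> * card V \<le> (\<Sum>g\<in>nsets V i. 0) + c / 2 ^ (i + 3) * real q"
        using q(1) Suc.prems by (simp add: field_simps)
      show "wdeg V i (\<lambda>_. 0) J \<le> 2 * \<tau> ^ card J" for J
        using \<tau> by (simp add: wdeg_def)
      show "I \<in> independent_sets V i (\<lambda>_. 0)" if "I \<in> independent_sets V (Suc i) w" for I
        using that by (simp add: independent_sets_def)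
      show "1 \<le> binomial_sum (card V) q ^ i" using binomial_sum_ge_1 by simp
    qed (use V \<tau> bal tot q \<delta> Suc.prems in auto)
    moreover have "{I \<in> independent_sets V (Suc i) w. {} \<subseteq> I \<and> I \<subseteq> V \<union> {}} = independent_sets V (Suc i) w"
      by (auto simp: independent_sets_def)
    ultimately show "covered (independent_sets V (Suc i) w) (binomial_sum (card V) q ^ Suc i) ((1 - \<delta>) * card V)"
      by simp
  qed (use \<delta> d in auto)
qed

section \<open>Copies of a hypergraph\<close>

text \<open>A copy is identified with its edge set, so that copies become hyperedges on the vertex
  set \<open>E\<close> for the container lemma. The set \<open>X\<close> is kept since isolated
  vertices of \<open>H\<close> must find room too.\<close>

definition copies :: "'a hypergraph \<Rightarrow> 'b set \<Rightarrow> 'b set set \<Rightarrow> 'b set set set" where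
  "copies H X E = {(\<lambda>e. f ` e) ` edges H | f.
     inj_on f (verts H) \<and> f ` verts H \<subseteq> X \<and> (\<forall>e\<in>edges H. f ` e \<in> E)}"

lemma copiesI:
  assumes "T = (\<lambda>e. f ` e) ` edges H" "inj_on f (verts H)" "f ` verts H \<subseteq> X"
    "\<forall>e\<in>edges H. f ` e \<in> E"
  shows "T \<in> copies H X E"
  unfolding copies_def mem_Collect_eq by (rule exI[of _ f]) (simp add: assms)

lemma copiesE:
  assumes "T \<in> copies H X E"
  obtains f where "T = (\<lambda>e. f ` e) ` edges H" "inj_on f (verts H)" "f ` verts H \<subseteq> X"
    "\<forall>e\<in>edges H. f ` e \<in> E"
proof -
  from assms obtain f where "T = (\<lambda>e. f ` e) ` edges H \<and>
    inj_on f (verts H) \<and> f ` verts H \<subseteq> X \<and> (\<forall>e\<in>edges H. f ` e \<in> E)"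
    unfolding copies_def mem_Collect_eq ..
  then show thesis by (intro that[of f]) simp_all
qed

lemma edge_subset_verts:
  assumes "uniform r H" "e \<in> edges H"
  shows "e \<subseteq> verts H" "finite e" "card e = r"
  using assms by (auto simp: uniform_def nsets_def)

lemma uniform_finite:
  assumes "uniform r H"
  shows "finite (verts H)" "finite (edges H)"
proof -
  show "finite (verts H)" using assms by (simp add: uniform_def)
  then have "finite (nsets (verts H) r)" by (rule finite_imp_finite_nsets)
  then show "finite (edges H)" using assms finite_subset unfolding uniform_def by blast
qed

lemma free_iff_copies:
  assumes "uniform r H"
  shows "free H (X, E) \<longleftrightarrow> copies H X E = {}"
proof
  assume fr: "free H (X, E)"
  show "copies H X E = {}"
  proof (rule ccontr)
    assume "copies H X E \<noteq> {}"
    then obtain T where "T \<in> copies H X E" by blast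
    then obtain f where f: "T = (\<lambda>e. f ` e) ` edges H" "inj_on f (verts H)" "f ` verts H \<subseteq> X"
      "\<forall>e\<in>edges H. f ` e \<in> E"
      by (rule copiesE)
    let ?F = "(f ` verts H, (\<lambda>e. f ` e) ` edges H)"
    have "subhypergraph ?F (X, E)"
      unfolding subhypergraph_def using f edge_subset_verts(1)[OF assms]
      by (auto simp: image_mono)
    moreover have "isomorphic H ?F"
      unfolding isomorphic_def using f by (intro exI[of _ f]) (auto simp: bij_betw_def)
    ultimately show False using fr unfolding free_def by blast
  qed
next
  assume *: "copies H X E = {}"
  show "free H (X, E)"
    unfolding free_def
  proof
    assume "\<exists>F. subhypergraph F (X, E) \<and> isomorphic H F"
    then obtain F f where F: "subhypergraph F (X, E)" "bij_betw f (verts H) (verts F)"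
      "edges F = (\<lambda>e. f ` e) ` edges H"
      unfolding isomorphic_def by blast
    have "(\<lambda>e. f ` e) ` edges H \<in> copies H X E"
      unfolding copies_def using F unfolding subhypergraph_def bij_betw_def by fastforce
    then show False using * by simp
  qed
qed

lemma copies_mono:
  assumes "X \<subseteq> Y" "E \<subseteq> F"
  shows "copies H X E \<subseteq> copies H Y F"
proof
  fix T assume "T \<in> copies H X E"
  then obtain f where f: "T = (\<lambda>e. f ` e) ` edges H" "inj_on f (verts H)" "f ` verts H \<subseteq> X"
    "\<forall>e\<in>edges H. f ` e \<in> E"
    by (rule copiesE)
  then have "f ` verts H \<subseteq> Y" "\<forall>e\<in>edges H. f ` e \<in> F" using assms by auto
  then show "T \<in> copies H Y F" using f(1,2) by (intro copiesI)
qed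

lemma copies_subset_nsets:
  assumes "uniform r H"
  shows "copies H X E \<subseteq> nsets E (card (edges H))"
proof
  fix T assume "T \<in> copies H X E"
  then obtain f where f: "T = (\<lambda>e. f ` e) ` edges H" "inj_on f (verts H)" "f ` verts H \<subseteq> X"
      "\<forall>e\<in>edges H. f ` e \<in> E"
    by (rule copiesE)
  have fin: "finite (edges H)"
    using uniform_finite[OF assms] by simp
  have "inj_on (\<lambda>e. f ` e) (edges H)"
    using f(2) edge_subset_verts(1)[OF assms] by (meson inj_onI inj_on_image_eq_iff)
  then show "T \<in> nsets E (card (edges H))"
    using f fin by (auto simp: nsets_def card_image)
qed

lemma copies_restrict:
  assumes "T \<in> copies H X E" "T \<subseteq> F"
  shows "T \<in> copies H X F"
proof -
  obtain f where f: "T = (\<lambda>e. f ` e) ` edges H" "inj_on f (verts H)" "f ` verts H \<subseteq> X"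
    "\<forall>e\<in>edges H. f ` e \<in> E"
    using assms(1) by (rule copiesE)
  moreover have "\<forall>e\<in>edges H. f ` e \<in> F" using f(1) assms(2) by auto
  ultimately show ?thesis by (intro copiesI)
qed

lemma card_edges_le_ex:
  fixes X :: "nat set"
  assumes "finite X" "E \<subseteq> nsets X r" "free H (X, E)"
  shows "card E \<le> ex r (card X) H"
  unfolding ex_def
proof (rule Max_ge)
  show "finite {card (edges G) |G :: nat hypergraph. uniform r G \<and> card (verts G) = card X \<and> free H G}"
  proof (rule finite_subset)
    show "{card (edges G) |G :: nat hypergraph. uniform r G \<and> card (verts G) = card X \<and> free H G}
      \<subseteq> {..card X choose r}"
    proof
      fix k assume "k \<in> {card (edges G) |G :: nat hypergraph. uniform r G \<and> card (verts G) = card X \<and> free H G}"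
      then obtain G :: "nat hypergraph" where G: "k = card (edges G)" "uniform r G" "card (verts G) = card X"
        by blast
      then have "card (edges G) \<le> card (nsets (verts G) r)"
        unfolding uniform_def by (intro card_mono) (auto simp: finite_imp_finite_nsets)
      then show "k \<in> {..card X choose r}" using G by simp
    qed
  qed simp
  show "card E \<in> {card (edges G) |G :: nat hypergraph. uniform r G \<and> card (verts G) = card X \<and> free H G}"
    using assms by (intro CollectI exI[of _ "(X, E)"]) (auto simp: uniform_def)
qed

text \<open>For a maximal edge-disjoint family, the edges it leaves uncovered span no copy of
  \<open>H\<close>, as such a copy could be added. At most \<open>ex r (card X) H\<close> edges are
  therefore left over.\<close>

lemma disjoint_copies_exist:
  fixes X :: "nat set"
  assumes H: "uniform r H" "edges H \<noteq> {}" and X: "finite X" "E \<subseteq> nsets X r"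
  shows "\<exists>M. M \<subseteq> copies H X E \<and> disjoint M \<and> card E \<le> card (edges H) * card M + ex r (card X) H"
proof -
  have finE: "finite E" using X finite_imp_finite_nsets finite_subset by blast
  have finc: "finite (copies H X E)"
    using copies_subset_nsets[OF H(1), of X E] finE finite_imp_finite_nsets finite_subset by blast
  define P where "P = {M. M \<subseteq> copies H X E \<and> disjoint M}"
  have "finite P" unfolding P_def using finc by simp
  moreover have "P \<noteq> {}" unfolding P_def by (auto intro: exI[of _ "{}"])
  ultimately obtain M where M: "M \<in> P" "\<And>M'. M' \<in> P \<Longrightarrow> M \<subseteq> M' \<Longrightarrow> M = M'"
    using finite_has_maximal[of P] by metis
  have Msub: "M \<subseteq> copies H X E" "disjoint M" using M(1) by (auto simp: P_def)
  define E' where "E' = E - \<Union>M"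
  have "copies H X E' = {}"
  proof (rule ccontr)
    assume "copies H X E' \<noteq> {}"
    then obtain T where T: "T \<in> copies H X E'" by blast
    then have TE: "T \<subseteq> E'" "T \<noteq> {}"
      using H(2) by (auto simp: copies_def)
    have "insert T M \<in> P"
      unfolding P_def using Msub T TE copies_mono[of X X E' E H]
      by (auto simp: E'_def disjoint_def)
    then have "T \<in> M" using M(2)[of "insert T M"] by blast
    then show False using TE unfolding E'_def by blast
  qed
  moreover have "E' \<subseteq> nsets X r" using X unfolding E'_def by blast
  ultimately have E': "card E' \<le> ex r (card X) H"
    using card_edges_le_ex[of X E' r H] X(1) free_iff_copies[OF H(1), of X E'] by blast
  have "card (\<Union>M) \<le> (\<Sum>T\<in>M. card T)"
    by (rule card_Union_le_sum_card)
  also have "\<dots> = (\<Sum>T\<in>M. card (edges H))"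
    using Msub copies_subset_nsets[OF H(1), of X E] by (intro sum.cong) (auto simp: nsets_def)
  finally have "card (\<Union>M) \<le> card (edges H) * card M" by (simp add: mult.commute)
  moreover have "card E \<le> card E' + card (\<Union>M)"
  proof -
    have "finite (\<Union>M)"
      using Msub finE copies_subset_nsets[OF H(1), of X E]
      by (intro finite_subset[OF _ finE]) (auto simp: nsets_def)
    then have "card E \<le> card (E' \<union> \<Union>M)"
      using finE by (intro card_mono) (auto simp: E'_def)
    then show ?thesis using card_Un_le[of E' "\<Union>M"] by linarith
  qed
  ultimately show ?thesis using Msub E' by (intro exI[of _ M]) auto
qed

lemma le_density:
  assumes "uniform r H" "subhypergraph F H" "r < card (verts F)"
  shows "(real (card (edges F)) - 1) / (real (card (verts F)) - real r) \<le> density r H"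
  unfolding density_def
proof (rule Max_ge)
  have fin: "finite (verts H)" "finite (edges H)"
    using uniform_finite[OF assms(1)] by auto
  have "{F. subhypergraph F H \<and> card (verts F) > r} \<subseteq> Pow (verts H) \<times> Pow (edges H)"
    by (auto simp: subhypergraph_def)
  then have "finite {F. subhypergraph F H \<and> card (verts F) > r}"
    by (rule finite_subset) (simp add: fin)
  then have "finite ((\<lambda>F. (real (card (edges F)) - 1) / (real (card (verts F)) - real r)) `
       {F. subhypergraph F H \<and> card (verts F) > r})" by (rule finite_imageI)
  then show "finite {(real (card (edges F)) - 1) / (real (card (verts F)) - real r) |F.
     subhypergraph F H \<and> r < card (verts F)}"
    by (simp add: image_Collect)
qed (use assms in blast)

lemma card_edges_le_density:
  assumes H: "uniform r H" and J: "J \<subseteq> edges H" "J \<noteq> {}"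
  shows "r \<le> card (\<Union>J)" "real (card J - 1) \<le> density r H * real (card (\<Union>J) - r)"
proof -
  have fin: "finite (verts H)" "finite (edges H)"
    using uniform_finite[OF H] by auto
  have sub: "\<Union>J \<subseteq> verts H" using J edge_subset_verts(1)[OF H] by blast
  then have finJ: "finite (\<Union>J)" using fin(1) finite_subset by blast
  obtain e where e: "e \<in> J" using J by blast
  have er: "card e = r" using e J edge_subset_verts(3)[OF H] by blast
  have "e \<subseteq> \<Union>J" using e by blast
  then show r: "r \<le> card (\<Union>J)" using er card_mono[OF finJ] by blast
  show "real (card J - 1) \<le> density r H * real (card (\<Union>J) - r)"
  proof (cases "r < card (\<Union>J)")
    case True
    have "subhypergraph (\<Union>J, J) H" using sub J by (auto simp: subhypergraph_def)
    from le_density[OF H this] True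
    have "(real (card J) - 1) / (real (card (\<Union>J)) - real r) \<le> density r H" by simp
    moreover have "card J \<noteq> 0" using J fin finite_subset by fastforce
    ultimately show ?thesis using True by (simp add: field_simps of_nat_diff)
  next
    case False
    then have "card (\<Union>J) = r" using r by simp
    have "d = \<Union>J" if "d \<in> J" for d
    proof (rule card_subset_eq[OF finJ])
      show "d \<subseteq> \<Union>J" using that by blast
      show "card d = card (\<Union>J)"
        using that J edge_subset_verts(3)[OF H] \<open>card (\<Union>J) = r\<close> by blast
    qed
    then have "J \<subseteq> {\<Union>J}" by blast
    then have "card J \<le> 1" using card_mono[of "{\<Union>J}" J] by simp
    then show ?thesis using False by simp
  qed
qed

lemma card_copies_le_density:
  assumes H: "uniform r H" and T: "T \<in> copies H X E" and J: "J \<subseteq> T" "J \<noteq> {}"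
  shows "r \<le> card (\<Union>J)" "real (card J - 1) \<le> density r H * real (card (\<Union>J) - r)"
proof -
  obtain f where f: "T = (\<lambda>e. f ` e) ` edges H" "inj_on f (verts H)" "f ` verts H \<subseteq> X"
      "\<forall>e\<in>edges H. f ` e \<in> E"
    using T by (rule copiesE)
  obtain K where K: "K \<subseteq> edges H" "J = (\<lambda>e. f ` e) ` K"
    using J(1) f(1) by (meson subset_imageE)
  have "inj_on (\<lambda>e. f ` e) (edges H)"
    using f(2) edge_subset_verts(1)[OF H] by (meson inj_onI inj_on_image_eq_iff)
  then have 1: "card J = card K" using K by (metis card_image inj_on_subset)
  have "\<Union>K \<subseteq> verts H" using K(1) edge_subset_verts(1)[OF H] by blast
  moreover have "\<Union>J = f ` \<Union>K" using K(2) by blast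
  ultimately have 2: "card (\<Union>J) = card (\<Union>K)" using f(2) by (metis card_image inj_on_subset)
  have "K \<noteq> {}" using J(2) K(2) by blast
  then show "r \<le> card (\<Union>J)" "real (card J - 1) \<le> density r H * real (card (\<Union>J) - r)"
    using card_edges_le_density[OF H K(1)] 1 2 by auto
qed

section \<open>Probability that a random \<open>m\<close>-subset contains a given set\<close>

lemma card_nsets_supersets:
  assumes "finite V" "U \<subseteq> V" "card U \<le> m"
  shows "card {R \<in> nsets V m. U \<subseteq> R} = (card V - card U) choose (m - card U)"
proof -
  have finU: "finite U" using assms finite_subset by blast
  have "bij_betw (\<lambda>S. S \<union> U) (nsets (V - U) (m - card U)) {R \<in> nsets V m. U \<subseteq> R}"
  proof (rule bij_betw_byWitness[where f' = "\<lambda>R. R - U"])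
    show "(\<lambda>S. S \<union> U) ` nsets (V - U) (m - card U) \<subseteq> {R \<in> nsets V m. U \<subseteq> R}"
    proof clarify
      fix S assume S: "S \<in> nsets (V - U) (m - card U)"
      then have "card (S \<union> U) = card S + card U"
        using finU by (intro card_Un_disjoint) (auto simp: nsets_def)
      then show "S \<union> U \<in> nsets V m \<and> U \<subseteq> S \<union> U"
        using S assms finU by (auto simp: nsets_def)
    qed
    show "(\<lambda>R. R - U) ` {R \<in> nsets V m. U \<subseteq> R} \<subseteq> nsets (V - U) (m - card U)"
      using finU by (auto simp: nsets_def card_Diff_subset)
  qed (auto simp: nsets_def)
  then have "card {R \<in> nsets V m. U \<subseteq> R} = card (nsets (V - U) (m - card U))"
    by (metis bij_betw_same_card)
  then show ?thesis using assms finU by (simp add: card_Diff_subset)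
qed

text \<open>The ratio of the two binomials is a product of factors \<open>(m - j) / (n - j)\<close>,
  each at most \<open>m / n\<close> because \<open>m \<le> n\<close>. The induction multiplies by
  one factor at a time.\<close>

lemma binomial_mult_power_le:
  assumes "m \<le> n"
  shows "real (m choose v) * real n ^ v \<le> real (n choose v) * real m ^ v"
proof (induction v)
  case (Suc v)
  have absorb: "real (Suc v) * real (k choose Suc v) = real (k choose v) * (real k - real v)" for k
  proof (cases "v \<le> k")
    case True
    have "Suc v * (k choose Suc v) = k * ((k - 1) choose v)"
      by (rule binomial_absorption)
    also have "\<dots> = (k choose v) * (k - v)"
      by (subst binomial_absorb_comp[symmetric]) (rule mult.commute)
    finally have "Suc v * (k choose Suc v) = (k choose v) * (k - v)" .
    then have "real (Suc v * (k choose Suc v)) = real ((k choose v) * (k - v))" by (rule arg_cong)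
    then show ?thesis using True by (simp only: of_nat_diff of_nat_mult)
  qed (simp only: binomial_eq_0 not_le less_Suc_eq, simp)
  show ?case
  proof (cases "v \<le> m")
    case True
    have le: "(real m - real v) * real n \<le> (real n - real v) * real m"
      using mult_left_mono[of "real m" "real n" "real v"] assms by (simp add: algebra_simps)
    have eq: "real (Suc v) * (real (k choose Suc v) * x ^ Suc v)
        = (real (k choose v) * x ^ v) * ((real k - real v) * x)" for k and x :: real
    proof -
      have "real (Suc v) * (real (k choose Suc v) * x ^ Suc v)
          = (real (Suc v) * real (k choose Suc v)) * (x ^ v * x)"
        by (simp only: power_Suc2 mult.assoc)
      also have "\<dots> = (real (k choose v) * (real k - real v)) * (x ^ v * x)"
        by (simp only: absorb)
      finally show ?thesis by (simp only: mult_ac)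
    qed
    have "real (Suc v) * (real (m choose Suc v) * real n ^ Suc v)
        = (real (m choose v) * real n ^ v) * ((real m - real v) * real n)"
      by (rule eq)
    also have "\<dots> \<le> (real (n choose v) * real m ^ v) * ((real n - real v) * real m)"
      by (rule mult_mono[OF Suc le]) (use True in auto)
    also have "\<dots> = real (Suc v) * (real (n choose Suc v) * real m ^ Suc v)"
      by (rule eq[symmetric])
    finally show ?thesis by (simp only: mult_le_cancel_left_pos of_nat_0_less_iff zero_less_Suc)
  next
    case False
    then have "m < Suc v" by simp
    then have "real (m choose Suc v) = 0" by (simp only: binomial_eq_0 of_nat_0)
    moreover have "0 \<le> real (n choose Suc v) * real m ^ Suc v"
      by (intro mult_nonneg_nonneg zero_le_power of_nat_0_le_iff)
    ultimately show ?thesis by (simp only: mult_zero_left)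
  qed
qed simp

text \<open>After division by \<open>card V choose m\<close> this bounds the probability of
  containing \<open>U\<close>, whose exact value
  \<open>(m choose card U) / (card V choose card U)\<close> comes from
  \<open>choose_mult\<close>.\<close>

lemma card_nsets_supersets_le:
  assumes "finite V" "U \<subseteq> V" "m \<le> card V"
  shows "real (card {R \<in> nsets V m. U \<subseteq> R}) \<le> real (card V choose m) * (real m / real (card V)) ^ card U"
proof (cases "card U \<le> m")
  case True
  have "card U \<le> card V" using assms by (simp add: card_mono)
  then have pos: "0 < real (card V choose card U)" by simp
  show ?thesis
  proof (cases "card V = 0")
    case True
    then show ?thesis using assms by (simp add: card_nsets_supersets)
  next
    case False
    have "real (card V choose card U) * real (card {R \<in> nsets V m. U \<subseteq> R}) * real (card V) ^ card U
       = real ((card V choose m) * (m choose card U)) * real (card V) ^ card U"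
      using choose_mult[OF True assms(3)] card_nsets_supersets[OF assms(1,2) True] by simp
    also have "\<dots> \<le> real (card V choose m) * (real (card V choose card U) * real m ^ card U)"
      using binomial_mult_power_le[OF assms(3), of "card U"] by (simp add: mult.assoc mult_left_mono)
    finally have "real (card V choose card U) * (real (card {R \<in> nsets V m. U \<subseteq> R}) * real (card V) ^ card U)
       \<le> real (card V choose card U) * (real (card V choose m) * real m ^ card U)"
      by (simp add: mult_ac)
    then have "real (card {R \<in> nsets V m. U \<subseteq> R}) * real (card V) ^ card U \<le> real (card V choose m) * real m ^ card U"
      using pos by (simp only: mult_le_cancel_left_pos)
    then show ?thesis using False by (simp add: power_divide field_simps)
  qed
next
  case False
  have "R \<notin> nsets V m" if "U \<subseteq> R" for R
    using that False card_mono[of R U] by (auto simp: nsets_def)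
  then have "{R \<in> nsets V m. U \<subseteq> R} = {}" by blast
  then show ?thesis by (simp only: card.empty) simp
qed

section \<open>Balanced supersaturation\<close>

text \<open>The converse estimate: an \<open>r\<close>-set is contained with probability
  \<open>(m choose r) / (n choose r)\<close>, where the numerator is at least
  \<open>(m / r) ^ r\<close> and the denominator at most \<open>n ^ r\<close>. Thus
  \<open>(m / n) ^ r\<close> is sharp up to the factor \<open>r ^ r\<close>.\<close>

lemma binomial_shift_ge:
  fixes m n r :: nat
  assumes m: "r \<le> m" "0 < m" "m \<le> n"
  shows "real (n choose m) * (real m / real n) ^ r \<le> real ((n - r) choose (m - r)) * real r ^ r"
proof -
  define Z where "Z = real ((n - r) choose (m - r))"
  have rr: "0 < real r ^ r" by (cases r) auto
  have "real (n choose m) * (real m / real r) ^ r \<le> real (n choose m) * real (m choose r)"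
    using binomial_ge_n_over_k_pow_k[OF m(1), where 'a = real] by (simp add: mult_left_mono)
  also have "\<dots> = real (n choose r) * Z"
    using choose_mult[OF m(1) m(3)] unfolding Z_def by (metis of_nat_mult)
  also have "\<dots> \<le> real n ^ r * Z"
  proof (rule mult_right_mono)
    show "real (n choose r) \<le> real n ^ r"
      using binomial_le_pow[of r n] m by (metis le_trans of_nat_le_iff of_nat_power)
  qed (simp add: Z_def)
  finally have "real (n choose m) * (real m / real r) ^ r / real n ^ r \<le> Z"
    using m by (simp add: divide_le_eq mult.commute)
  then have "real (n choose m) * (real m / real r) ^ r / real n ^ r * real r ^ r \<le> Z * real r ^ r"
    using rr by (intro mult_right_mono) auto
  moreover have "real (n choose m) * (real m / real r) ^ r / real n ^ r * real r ^ r
      = real (n choose m) * (real m / real n) ^ r"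
    using rr by (simp add: power_divide)
  ultimately show ?thesis by (simp add: Z_def)
qed

text \<open>
  In every \<open>m\<close>-subset \<open>R\<close> of the vertices choose a maximal family \<open>M R\<close> of edge-disjoint copies of \<open>H\<close>;
  the weight of a copy is, up to normalisation, the number of sets \<open>R\<close> whose family contains it. Since at most one
  member of \<open>M R\<close> contains a given nonempty set \<open>J\<close> of edges, the degree of \<open>J\<close> is at most the
  probability that a random \<open>R\<close> contains \<open>\<Union>J\<close>.
\<close>

lemma supersaturation:
  fixes H :: "'a hypergraph" and E :: "nat set set"
  defines "s \<equiv> card (edges H)"
  assumes H: "uniform r H" "edges H \<noteq> {}" and d: "0 < density r H"
    and E: "E \<subseteq> nsets {1..n} r" and m: "r \<le> m" "0 < m" "m \<le> n"
    and many: "2 * real (ex r m H) * real (n choose m) \<le> real (card E) * real ((n - r) choose (m - r))"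
  shows "\<exists>w. balanced E s ((real m / real n) powr (1 / density r H)) w \<and>
     1 / (2 * real s * real r ^ r) * real (card E) \<le> (\<Sum>T\<in>nsets E s. w T) \<and>
     (\<forall>I. I \<subseteq> E \<longrightarrow> free H ({1..n}, I) \<longrightarrow> I \<in> independent_sets E s w)"
proof -
  define V where "V = {1..n}"
  define p where "p = real m / real n"
  define \<tau> where "\<tau> = p powr (1 / density r H)"
  have V: "finite V" "card V = n" by (auto simp: V_def)
  have p: "0 < p" "p \<le> 1" using m by (auto simp: p_def)
  have finE: "finite E" using E finite_imp_finite_nsets finite_subset by blast
  have finR: "finite (nsets V m)" using V by (simp add: finite_imp_finite_nsets)
  have s: "0 < s"
    unfolding s_def using H(2) uniform_finite(2)[OF H(1)] by (simp add: card_gt_0_iff)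
  have nm: "0 < real (n choose m)" using m by simp
  have ER: "E \<inter> nsets R r \<subseteq> nsets R r" for R by blast
  have "\<exists>M. M \<subseteq> copies H R (E \<inter> nsets R r) \<and> disjoint M \<and>
      card (E \<inter> nsets R r) \<le> s * card M + ex r m H" if "R \<in> nsets V m" for R
    using disjoint_copies_exist[OF H, of R "E \<inter> nsets R r"] that unfolding s_def nsets_def by auto
  then obtain M where M: "\<And>R. R \<in> nsets V m \<Longrightarrow> M R \<subseteq> copies H R (E \<inter> nsets R r)"
    "\<And>R. R \<in> nsets V m \<Longrightarrow> disjoint (M R)"
    "\<And>R. R \<in> nsets V m \<Longrightarrow> card (E \<inter> nsets R r) \<le> s * card (M R) + ex r m H"
    by metis
  have MV: "M R \<subseteq> copies H V E" if "R \<in> nsets V m" for R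
  proof -
    have "copies H R (E \<inter> nsets R r) \<subseteq> copies H V E"
      using that by (intro copies_mono) (auto simp: nsets_def)
    then show ?thesis using M(1)[OF that] by blast
  qed
  have Ms: "M R \<subseteq> nsets E s" if "R \<in> nsets V m" for R
    using MV[OF that] copies_subset_nsets[OF H(1), of V E] unfolding s_def by blast
  have finT: "finite (nsets E s)" using finE by (rule finite_imp_finite_nsets)
  \<comment> \<open>Up to a constant factor, the number of samples that contain a fixed edge.
    Dividing by it brings the degree of a single edge of \<open>E\<close> down to at most 1.\<close>
  define K where "K = real (n choose m) * p ^ r"
  have K: "0 < K" using nm p by (simp add: K_def)
  define w where "w T = real (card {R \<in> nsets V m. T \<in> M R}) / K" for T
  have wdeg: "wdeg E s w J = (\<Sum>R\<in>nsets V m. real (card {T \<in> M R. J \<subseteq> T})) / K" for J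
  proof -
    have "wdeg E s w J = (\<Sum>T\<in>{T \<in> nsets E s. J \<subseteq> T}. \<Sum>R\<in>nsets V m. if T \<in> M R then 1 else 0) / K"
      unfolding wdeg_def w_def using finR by (simp add: sum_divide_distrib flip: sum.inter_filter)
    also have "(\<Sum>T\<in>{T \<in> nsets E s. J \<subseteq> T}. \<Sum>R\<in>nsets V m. if T \<in> M R then 1 else (0::real))
       = (\<Sum>R\<in>nsets V m. \<Sum>T\<in>{T \<in> nsets E s. J \<subseteq> T}. if T \<in> M R then 1 else 0)"
      by (rule sum.swap)
    also have "\<dots> = (\<Sum>R\<in>nsets V m. real (card {T \<in> M R. J \<subseteq> T}))"
    proof (rule sum.cong)
      fix R assume R: "R \<in> nsets V m"
      have "{T \<in> {T \<in> nsets E s. J \<subseteq> T}. T \<in> M R} = {T \<in> M R. J \<subseteq> T}" using Ms[OF R] by blast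
      moreover have "finite {T \<in> nsets E s. J \<subseteq> T}" using finT by simp
      ultimately show "(\<Sum>T\<in>{T \<in> nsets E s. J \<subseteq> T}. if T \<in> M R then 1 else 0) = real (card {T \<in> M R. J \<subseteq> T})"
        by (simp flip: sum.inter_filter)
    qed simp
    finally show ?thesis .
  qed
  have "balanced E s \<tau> w"
    unfolding balanced_def
  proof (intro conjI allI impI)
    show "0 \<le> w T" for T using K by (simp add: w_def)
    fix J assume J: "J \<subseteq> E" "J \<noteq> {}"
    show "wdeg E s w J \<le> \<tau> ^ (card J - 1)"
    \<comment> \<open>The density bound on \<open>card J\<close> holds only inside a copy of
      \<open>H\<close>; a set \<open>J\<close> in no chosen copy has degree 0.\<close>
    proof (cases "\<exists>R\<in>nsets V m. \<exists>T\<in>M R. J \<subseteq> T")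
      case False
      then have none: "{T \<in> M R. J \<subseteq> T} = {}" if "R \<in> nsets V m" for R using that by blast
      have "(\<Sum>R\<in>nsets V m. real (card {T \<in> M R. J \<subseteq> T})) = 0"
      proof (rule sum.neutral, rule ballI)
        fix R assume "R \<in> nsets V m"
        then show "real (card {T \<in> M R. J \<subseteq> T}) = 0" by (simp only: none card.empty of_nat_0)
      qed
      then have "wdeg E s w J = 0" unfolding wdeg by simp
      then show ?thesis by (simp add: \<tau>_def)
    next
      case True
      then obtain R T where "R \<in> nsets V m" "T \<in> M R" "J \<subseteq> T" by blast
      then have T: "T \<in> copies H V E" "J \<subseteq> T" using MV by auto
      define u where "u = card (\<Union>J)"
      have u: "r \<le> u" "real (card J - 1) \<le> density r H * real (u - r)"
        using card_copies_le_density[OF H(1) T J(2)] by (auto simp: u_def)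
      have UV: "\<Union>J \<subseteq> V" using J E by (force simp: V_def nsets_def)
      have "(\<Sum>R\<in>nsets V m. real (card {T \<in> M R. J \<subseteq> T})) \<le> (\<Sum>R\<in>nsets V m. if \<Union>J \<subseteq> R then 1 else 0)"
      proof (rule sum_mono)
        fix R assume R: "R \<in> nsets V m"
        have "\<Union>J \<subseteq> R" if "T \<in> M R" "J \<subseteq> T" for T
        proof -
          have "T \<in> nsets (E \<inter> nsets R r) s"
            using M(1)[OF R] that(1) copies_subset_nsets[OF H(1), of R] unfolding s_def by blast
          then have "T \<subseteq> nsets R r" by (simp add: nsets_def)
          then show ?thesis using that(2) by (auto simp: nsets_def)
        qed
        moreover have "T = T'" if "T \<in> M R" "J \<subseteq> T" "T' \<in> M R" "J \<subseteq> T'" for T T'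
        proof (rule ccontr)
          assume "T \<noteq> T'"
          then have "T \<inter> T' = {}" using disjointD[OF M(2)[OF R]] that by simp
          then show False using that J(2) by blast
        qed
        moreover have "finite {T \<in> M R. J \<subseteq> T}"
          using finite_subset[OF Ms[OF R] finT] by simp
        ultimately have "card {T \<in> M R. J \<subseteq> T} \<le> 1" "card {T \<in> M R. J \<subseteq> T} \<noteq> 0 \<Longrightarrow> \<Union>J \<subseteq> R"
          by (auto simp: card_le_Suc0_iff_eq)
        then show "real (card {T \<in> M R. J \<subseteq> T}) \<le> (if \<Union>J \<subseteq> R then 1 else 0)"
          by auto
      qed
      also have "\<dots> = real (card {R \<in> nsets V m. \<Union>J \<subseteq> R})"
        using finR by (simp flip: sum.inter_filter)
      also have "\<dots> \<le> real (n choose m) * p ^ u"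
        using card_nsets_supersets_le[OF V(1) UV, of m] V m unfolding p_def u_def by simp
      finally have "wdeg E s w J \<le> real (n choose m) * p ^ u / K"
        unfolding wdeg using K by (simp add: divide_right_mono)
      also have "\<dots> = p ^ (u - r)"
        using nm p u(1) by (simp add: K_def power_diff)
      also have "\<dots> = p powr real (u - r)" using p by (simp add: powr_realpow)
      \<comment> \<open>Here the \<open>r\<close>-density determines \<tau>:
        \<open>card J - 1\<close> edges beyond the first force at least
        \<open>(card J - 1) / density r H\<close> further vertices, and
        \<open>p \<le> 1\<close>.\<close>
      also have "\<dots> \<le> p powr (real (card J - 1) / density r H)"
        using u(2) d p by (intro powr_mono') (simp_all add: field_simps)
      also have "\<dots> = \<tau> ^ (card J - 1)"
        using p unfolding \<tau>_def by (simp add: powr_realpow[symmetric] powr_powr)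
      finally show ?thesis .
    qed
  qed
  moreover have "1 / (2 * real s * real r ^ r) * real (card E) \<le> (\<Sum>T\<in>nsets E s. w T)"
  proof -
    define Z where "Z = real ((n - r) choose (m - r))"
    have "(\<Sum>R\<in>nsets V m. real (card (E \<inter> nsets R r)))
       = (\<Sum>R\<in>nsets V m. \<Sum>e\<in>E. if e \<subseteq> R then 1 else 0)"
    proof (rule sum.cong)
      fix R assume "R \<in> nsets V m"
      have "{e \<in> E. e \<subseteq> R} = E \<inter> nsets R r" using E by (auto simp: nsets_def)
      then show "real (card (E \<inter> nsets R r)) = (\<Sum>e\<in>E. if e \<subseteq> R then 1 else 0)"
        using finE by (simp flip: sum.inter_filter)
    qed simp
    also have "\<dots> = (\<Sum>e\<in>E. \<Sum>R\<in>nsets V m. if e \<subseteq> R then 1 else 0)"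
      by (rule sum.swap)
    also have "\<dots> = (\<Sum>e\<in>E. Z)"
    proof (rule sum.cong)
      fix e assume "e \<in> E"
      then have e: "e \<subseteq> V" "card e = r" using E by (auto simp: V_def nsets_def)
      have "(\<Sum>R\<in>nsets V m. if e \<subseteq> R then 1 else 0) = real (card {R \<in> nsets V m. e \<subseteq> R})"
        using finR by (simp flip: sum.inter_filter)
      then show "(\<Sum>R\<in>nsets V m. if e \<subseteq> R then 1 else 0) = Z"
        using card_nsets_supersets[OF V(1) e(1), of m] e(2) V(2) m(1) by (simp add: Z_def)
    qed simp
    finally have "real (card E) * Z = (\<Sum>R\<in>nsets V m. real (card (E \<inter> nsets R r)))" by simp
    also have "\<dots> \<le> (\<Sum>R\<in>nsets V m. real s * real (card (M R)) + real (ex r m H))"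
      using M(3) by (intro sum_mono) (metis of_nat_add of_nat_le_iff of_nat_mult)
    also have "\<dots> = real s * (\<Sum>R\<in>nsets V m. real (card (M R))) + real (n choose m) * real (ex r m H)"
      using V by (simp add: sum.distrib sum_distrib_left)
    also have "(\<Sum>R\<in>nsets V m. real (card (M R))) = K * (\<Sum>T\<in>nsets E s. w T)"
      using wdeg[of "{}"] K by (simp add: wdeg_empty)
    finally have "real (card E) * Z \<le> real s * (K * (\<Sum>T\<in>nsets E s. w T)) + real (n choose m) * real (ex r m H)" .
    \<comment> \<open>On average over the samples, the edges missed by the families make up at most
      half of all edges, so the chosen copies account for the other half.\<close>
    moreover have "2 * (real (n choose m) * real (ex r m H)) \<le> real (card E) * Z"
      using many by (simp add: Z_def mult_ac)
    moreover define W where "W = (\<Sum>T\<in>nsets E s. w T)"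
    ultimately have 1: "real (card E) * Z \<le> 2 * real s * (K * W)" by simp
    have rr: "0 < real r ^ r" by (cases r) auto
    have "K \<le> Z * real r ^ r"
      using binomial_shift_ge[OF m] unfolding K_def Z_def p_def .
    then have "real (card E) * K \<le> real (card E) * (Z * real r ^ r)" by (intro mult_left_mono) auto
    also have "\<dots> = real (card E) * Z * real r ^ r" by simp
    also have "\<dots> \<le> 2 * real s * (K * W) * real r ^ r"
      using 1 rr by (intro mult_right_mono) auto
    finally have "real (card E) * K \<le> (2 * real s * real r ^ r * W) * K" by (simp add: mult_ac)
    then have "real (card E) \<le> 2 * real s * real r ^ r * W" using K by simp
    then show ?thesis using s rr unfolding W_def by (simp add: field_simps)
  qed
  moreover have "I \<in> independent_sets E s w" if I: "I \<subseteq> E" "free H ({1..n}, I)" for I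
  proof -
    have none: "copies H V I = {}" using I(2) free_iff_copies[OF H(1), of V I] by (simp add: V_def)
    have "w T \<le> 0" if T: "T \<in> nsets I s" for T
    proof -
      have "T \<notin> M R" if "R \<in> nsets V m" for R
        using MV[OF that] copies_restrict[of T H V E I] T none unfolding nsets_def by blast
      then have "{R \<in> nsets V m. T \<in> M R} = {}" by blast
      then show ?thesis by (simp only: w_def card.empty of_nat_0 div_0 order_refl)
    qed
    then show ?thesis using I(1) by (simp add: independent_sets_def)
  qed
  ultimately show ?thesis unfolding \<tau>_def p_def by blast
qed

section \<open>Iterating containers\<close>

text \<open>The exponential moment bound: since \<open>x \<le> 1\<close>, weighting the
  \<open>k\<close>-th term by \<open>x ^ k\<close> in place of \<open>x ^ q\<close> only increases
  the sum, which the binomial theorem bounds by \<open>(1 + x) ^ u \<le> exp (u * x)\<close>. A good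
  \<open>x\<close> is of order \<open>q / u\<close>.\<close>

lemma ln_binomial_sum_le:
  assumes "0 < x" "x \<le> 1"
  shows "ln (real (binomial_sum u q)) \<le> real u * x + real q * ln (1 / x)"
proof -
  have "real (binomial_sum u q) * x ^ q = (\<Sum>k\<le>q. real (u choose k) * x ^ q)"
    by (simp add: binomial_sum_def sum_distrib_right)
  also have "\<dots> \<le> (\<Sum>k\<le>q. real (u choose k) * x ^ k)"
    using assms by (intro sum_mono mult_left_mono power_decreasing) auto
  also have "\<dots> \<le> (\<Sum>k\<le>max q u. real (u choose k) * x ^ k)"
    using assms by (intro sum_mono2) auto
  also have "\<dots> = (\<Sum>k\<le>u. real (u choose k) * x ^ k)"
    by (rule sum.mono_neutral_right) (auto simp: binomial_eq_0)
  also have "\<dots> = (x + 1) ^ u"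
    by (simp add: binomial_ring)
  also have "\<dots> \<le> exp x ^ u"
    using assms exp_ge_add_one_self[of x] by (intro power_mono) (auto simp: add.commute)
  also have "\<dots> = exp (real u * x)" by (simp add: exp_of_nat_mult)
  finally have le: "real (binomial_sum u q) * x ^ q \<le> exp (real u * x)" .
  have pos: "0 < real (binomial_sum u q)" using binomial_sum_ge_1[of u q] by simp
  have "ln (real (binomial_sum u q) * x ^ q) \<le> real u * x"
    using le pos assms by (metis ln_exp ln_le_cancel_iff exp_gt_zero mult_pos_pos zero_less_power)
  then show ?thesis using pos assms by (simp add: ln_mult ln_realpow ln_div)
qed

lemma card_le_of_covered:
  fixes B :: real
  assumes E: "finite E" and B0: "0 \<le> B" and cov: "covered {I \<in> \<F>. I \<subseteq> E} M x"
    and B: "\<And>D. D \<subseteq> E \<Longrightarrow> real (card D) \<le> x \<Longrightarrow> real (card {I \<in> \<F>. I \<subseteq> D}) \<le> B"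
  shows "real (card {I \<in> \<F>. I \<subseteq> E}) \<le> real M * B"
proof -
  obtain \<C> where C: "finite \<C>" "card \<C> \<le> M" "\<forall>C\<in>\<C>. finite C \<and> real (card C) \<le> x"
    "\<forall>I\<in>{I \<in> \<F>. I \<subseteq> E}. \<exists>C\<in>\<C>. I \<subseteq> C"
    using cov unfolding covered_def by blast
  have fin: "finite {I \<in> \<F>. I \<subseteq> D}" if "D \<subseteq> E" for D
    by (rule finite_subset[of _ "Pow E"]) (use that E in auto)
  have le: "real (card {I \<in> \<F>. I \<subseteq> C \<inter> E}) \<le> B" if "C \<in> \<C>" for C
  proof (rule B)
    have "card (C \<inter> E) \<le> card C" using C(3) that by (intro card_mono) auto
    then show "real (card (C \<inter> E)) \<le> x" using C(3) that by fastforce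
  qed simp
  have "{I \<in> \<F>. I \<subseteq> E} \<subseteq> (\<Union>C\<in>\<C>. {I \<in> \<F>. I \<subseteq> C \<inter> E})"
  proof
    fix I assume I: "I \<in> {I \<in> \<F>. I \<subseteq> E}"
    then obtain C where "C \<in> \<C>" "I \<subseteq> C" using C(4) by (elim ballE bexE) auto
    then show "I \<in> (\<Union>C\<in>\<C>. {I \<in> \<F>. I \<subseteq> C \<inter> E})" using I by auto
  qed
  then have "card {I \<in> \<F>. I \<subseteq> E} \<le> card (\<Union>C\<in>\<C>. {I \<in> \<F>. I \<subseteq> C \<inter> E})"
    by (intro card_mono finite_UN_I C(1) fin Int_lower2)
  also have "\<dots> \<le> (\<Sum>C\<in>\<C>. card {I \<in> \<F>. I \<subseteq> C \<inter> E})" by (rule card_UN_le[OF C(1)])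
  finally have "real (card {I \<in> \<F>. I \<subseteq> E}) \<le> real (\<Sum>C\<in>\<C>. card {I \<in> \<F>. I \<subseteq> C \<inter> E})"
    by (simp only: of_nat_le_iff)
  also have "\<dots> = (\<Sum>C\<in>\<C>. real (card {I \<in> \<F>. I \<subseteq> C \<inter> E}))"
    by (rule of_nat_sum)
  also have "\<dots> \<le> (\<Sum>C\<in>\<C>. B)" using le by (rule sum_mono)
  also have "\<dots> \<le> real M * B" using C(2) B0 by (simp add: mult_right_mono)
  finally show ?thesis .
qed

text \<open>
  The induction hypothesis carries the correction \<open>- K' * max t t\<^sub>1 powr (- \<theta>)\<close>, with \<open>t = card D / X\<close>,
  which absorbs the geometrically decreasing costs of the container steps.
\<close>

lemma iterated_containers:
  fixes X t\<^sub>0 \<delta> \<theta> K :: real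
  defines "K' \<equiv> K / ((1 - \<delta>) powr (- \<theta>) - 1)"
  defines "C \<equiv> t\<^sub>0 * ln 2 + K' * ((1 - \<delta>) * t\<^sub>0) powr (- \<theta>)"
  assumes X: "0 < X" and t0: "0 < t\<^sub>0" and \<delta>: "0 < \<delta>" "\<delta> < 1" and \<theta>: "0 < \<theta>" and K: "0 \<le> K"
    and E: "finite E"
    and step: "\<And>D. D \<subseteq> E \<Longrightarrow> t\<^sub>0 * X \<le> real (card D) \<Longrightarrow>
      \<exists>M. covered {I \<in> \<F>. I \<subseteq> D} M ((1 - \<delta>) * card D) \<and>
        real M \<le> exp (K * X * (real (card D) / X) powr (- \<theta>))"
  shows "real (card {I \<in> \<F>. I \<subseteq> E}) \<le> exp (C * X)"
proof -
  \<comment> \<open>Flooring the ratio at \<open>t\<^sub>1\<close> keeps the correction bounded for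
    small sets. The floor is harmless in the induction step, since \<open>t \<ge> t\<^sub>0\<close>
    gives \<open>(1 - \<delta>) * t \<ge> t\<^sub>1\<close>.\<close>
  define t\<^sub>1 where "t\<^sub>1 = (1 - \<delta>) * t\<^sub>0"
  have t1: "0 < t\<^sub>1" "t\<^sub>1 \<le> t\<^sub>0" using t0 \<delta> by (auto simp: t\<^sub>1_def mult_le_cancel_right1)
  have gt1: "1 < (1 - \<delta>) powr (- \<theta>)"
    using powr_less_mono2_neg[of "- \<theta>" "1 - \<delta>" 1] \<delta> \<theta> by simp
  have K': "0 \<le> K'" using gt1 K by (simp add: K'_def)
  have "real (card {I \<in> \<F>. I \<subseteq> D}) \<le> exp (X * (C - K' * max (real (card D) / X) t\<^sub>1 powr (- \<theta>)))"
    if "D \<subseteq> E" for D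
    using that
  proof (induction "card D" arbitrary: D rule: less_induct)
    case less
    define t where "t = real (card D) / X"
    have cD: "real (card D) = t * X" using X by (simp add: t_def)
    have finD: "finite D" using less.prems E finite_subset by blast
    show ?case
    proof (cases "t\<^sub>0 \<le> t")
      case False
      have "{I \<in> \<F>. I \<subseteq> D} \<subseteq> Pow D" by blast
      then have "card {I \<in> \<F>. I \<subseteq> D} \<le> 2 ^ card D"
        using finD card_mono[of "Pow D"] by (simp add: card_Pow)
      then have "real (card {I \<in> \<F>. I \<subseteq> D}) \<le> real (2 ^ card D)"
        by (simp only: of_nat_le_iff)
      also have "\<dots> = exp (real (card D) * ln 2)" by (simp add: exp_of_nat_mult)
      also have "\<dots> \<le> exp (X * (C - K' * max t t\<^sub>1 powr (- \<theta>)))"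
      proof -
        have "max t t\<^sub>1 powr (- \<theta>) \<le> t\<^sub>1 powr (- \<theta>)"
          using t1 \<theta> by (intro powr_mono2') auto
        then have "K' * max t t\<^sub>1 powr (- \<theta>) \<le> K' * t\<^sub>1 powr (- \<theta>)"
          using K' by (rule mult_left_mono)
        then have "t\<^sub>0 * ln 2 \<le> C - K' * max t t\<^sub>1 powr (- \<theta>)"
          by (simp add: C_def t\<^sub>1_def)
        moreover have "t * ln 2 \<le> t\<^sub>0 * ln 2" using False by simp
        ultimately have "t * ln 2 \<le> C - K' * max t t\<^sub>1 powr (- \<theta>)"
          by (rule order_trans[rotated])
        then have "X * (t * ln 2) \<le> X * (C - K' * max t t\<^sub>1 powr (- \<theta>))"
          using X by (intro mult_left_mono) auto
        then show ?thesis by (simp add: cD mult_ac)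
      qed
      finally show ?thesis unfolding t_def .
    next
      case True
      then have t: "0 < t" using t0 by simp
      have "t\<^sub>0 * X \<le> real (card D)" using True X by (simp add: cD)
      from step[OF less.prems this] obtain M where M: "covered {I \<in> \<F>. I \<subseteq> D} M ((1 - \<delta>) * card D)"
        "real M \<le> exp (K * X * t powr (- \<theta>))"
        unfolding t_def by (elim exE conjE)
      define B where "B = exp (X * (C - K' * ((1 - \<delta>) * t) powr (- \<theta>)))"
      have "real (card {I \<in> \<F>. I \<subseteq> D}) \<le> real M * B"
      proof (rule card_le_of_covered[OF finD _ M(1)])
        show "0 \<le> B" by (simp add: B_def)
      next
        fix D' assume D': "D' \<subseteq> D" "real (card D') \<le> (1 - \<delta>) * card D"
        have "(1 - \<delta>) * card D < card D" using t X \<delta> by (simp add: cD)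
        then have "card D' < card D" using D'(2) by linarith
        then have "real (card {I \<in> \<F>. I \<subseteq> D'}) \<le> exp (X * (C - K' * max (real (card D') / X) t\<^sub>1 powr (- \<theta>)))"
          by (rule less.hyps) (use D'(1) less.prems in simp_all)
        also have "\<dots> \<le> B"
        proof -
          have "real (card D') / X \<le> (1 - \<delta>) * t" using D'(2) X by (simp add: cD field_simps)
          moreover have "t\<^sub>1 \<le> (1 - \<delta>) * t" using True \<delta> by (simp add: t\<^sub>1_def)
          ultimately have "((1 - \<delta>) * t) powr (- \<theta>) \<le> max (real (card D') / X) t\<^sub>1 powr (- \<theta>)"
            using t1 \<theta> by (intro powr_mono2') auto
          then have "K' * ((1 - \<delta>) * t) powr (- \<theta>) \<le> K' * max (real (card D') / X) t\<^sub>1 powr (- \<theta>)"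
            using K' by (rule mult_left_mono)
          then show ?thesis using X unfolding B_def by simp
        qed
        finally show "real (card {I \<in> \<F>. I \<subseteq> D'}) \<le> B" .
      qed
      also have "\<dots> \<le> exp (K * X * t powr (- \<theta>)) * B"
        using M(2) by (intro mult_right_mono) (auto simp: B_def)
      also have "\<dots> = exp (X * (C - K' * t powr (- \<theta>)))"
      proof -
        \<comment> \<open>Passing to a container raises the correction from
          \<open>K' * t powr (- \<theta>)\<close> to at least
          \<open>(1 - \<delta>) powr (- \<theta>)\<close> times that. \<open>K'\<close> is the value
          for which this increase pays exactly for the \<open>K\<close> term of the step.\<close>
        have "K' * ((1 - \<delta>) powr (- \<theta>) - 1) = K" using gt1 by (simp add: K'_def)
        then have "K * X * t powr (- \<theta>) = K' * ((1 - \<delta>) powr (- \<theta>) - 1) * X * t powr (- \<theta>)"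
          by (simp only:)
        then have "K * X * t powr (- \<theta>) + X * (C - K' * ((1 - \<delta>) powr (- \<theta>) * t powr (- \<theta>)))
            = X * (C - K' * t powr (- \<theta>))"
          by (simp add: algebra_simps)
        then show ?thesis using t \<delta> by (simp add: B_def powr_mult flip: exp_add)
      qed
      also have "max t t\<^sub>1 = t" using True t1 by simp
      then have "exp (X * (C - K' * t powr (- \<theta>))) = exp (X * (C - K' * max t t\<^sub>1 powr (- \<theta>)))" by simp
      finally show ?thesis unfolding t_def .
    qed
  qed
  from this[OF subset_refl] show ?thesis
  proof (rule order_trans)
    have "C - K' * max (real (card E) / X) t\<^sub>1 powr (- \<theta>) \<le> C" using K' by simp
    then show "exp (X * (C - K' * max (real (card E) / X) t\<^sub>1 powr (- \<theta>))) \<le> exp (C * X)"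
      using X by (simp add: mult.commute)
  qed
qed

text \<open>A single edge cannot host two edges. The bound guarantees that the expected number of
  sampled edges is at least 1, which controls a rounding error below.\<close>

lemma ex_pos:
  assumes H: "uniform r H" "2 \<le> card (edges H)" and m: "r \<le> m"
  shows "1 \<le> ex r m H"
proof -
  have "copies H {1..m} {{1..r}} = {}"
  proof -
    have "nsets {{1..r}} (card (edges H)) = {}"
      using H(2) by (intro nsets_eq_empty) simp_all
    then show ?thesis using copies_subset_nsets[OF H(1), of "{1..m}" "{{1..r}}"] by simp
  qed
  then have "free H ({1..m}, {{1..r}})" using free_iff_copies[OF H(1), of "{1..m}" "{{1..r}}"] by simp
  then have "card {{1..r}} \<le> ex r (card {1..m}) H"
    using m by (intro card_edges_le_ex) (auto simp: nsets_def)
  then show ?thesis by simp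
qed

text \<open>
  The sample size \<open>m\<close> is chosen so that, by the bounds on \<open>ex r m H\<close>, a random \<open>m\<close>-subset contains on average
  at least \<open>2 * ex r m H\<close> edges of \<open>E\<close>. Then \<open>p = m / n\<close> is of order \<open>t powr (- 1 / \<gamma>)\<close>, and
  \<open>\<gamma> < 1 / density r H\<close> makes the fingerprint size \<open>q\<close> at most of order \<open>ex r n H * t powr (- \<eta>)\<close> with \<open>\<eta> > 0\<close>.
\<close>

lemma supersaturated_container:
  fixes H :: "'a hypergraph" and r :: nat and \<beta> :: real
  defines "\<gamma> \<equiv> real r - \<beta>"
  assumes H: "uniform r H" "2 \<le> card (edges H)"
    and d: "0 < density r H" "1 / density r H \<le> real r" and r: "1 \<le> r"
    and \<gamma>: "0 < \<gamma>" "\<gamma> < 1 / density r H"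
  shows "\<exists>t\<^sub>0 \<delta> \<theta> K :: real. 0 < t\<^sub>0 \<and> 0 < \<delta> \<and> \<delta> < 1 \<and> 0 < \<theta> \<and> 0 \<le> K \<and>
    (\<forall>n E. 0 < n \<and> 0 < ex r n H \<and>
       (\<forall>m\<in>{1..n}. real (ex r m H) * real n powr \<beta> \<le> real (ex r n H) * real m powr \<beta>) \<and>
       real r powr \<gamma> * real n powr \<beta> \<le> real (ex r n H) \<and>
       E \<subseteq> nsets {1..n} r \<and> t\<^sub>0 * real (ex r n H) \<le> real (card E) \<longrightarrow>
       (\<exists>M. covered {I \<in> {I. free H ({1..n}, I)}. I \<subseteq> E} M ((1 - \<delta>) * real (card E)) \<and>
          real M \<le> exp (K * real (ex r n H) * (real (card E) / real (ex r n H)) powr (- \<theta>))))"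
proof -
  define s where "s = card (edges H)"
  define \<mu> where "\<mu> = 1 / density r H"
  \<comment> \<open>The exponent \<eta> measures how far \<gamma> lies below \<mu>. In
    \<open>a\<close>, the 2 is the one in the hypothesis \<open>many\<close> of
    \<open>supersaturation\<close>, and \<open>r ^ r\<close> comes from
    \<open>binomial_shift_ge\<close>. In \<open>b\<close>, the factor 2 pays for rounding
    \<open>q\<close>, and \<open>2 powr \<mu>\<close> for rounding \<open>m\<close>.\<close>
  define \<eta> where "\<eta> = \<mu> / \<gamma> - 1"
  define a where "a = 2 * real r ^ r"
  define b where "b = 2 * 2 powr \<mu> * a powr (\<mu> / \<gamma>)"
  define c where "c = 1 / (2 * real s * real r ^ r)"
  have s: "2 \<le> s" using H by (simp add: s_def)
  have \<mu>: "0 < \<mu>" "\<mu> \<le> real r" "\<gamma> < \<mu>" using d \<gamma> by (auto simp: \<mu>_def)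
  have \<eta>: "0 < \<eta>" using \<gamma> \<mu> by (simp add: \<eta>_def)
  have rr: "1 \<le> real r ^ r" using r by simp
  have a: "2 \<le> a" using rr by (simp add: a_def)
  have b: "0 < b" using a by (simp add: b_def)
  have c: "0 < c" using s r by (simp add: c_def)
  obtain \<delta> :: real where \<delta>': "0 < \<delta> \<and> \<delta> < 1 \<and> (\<forall>(V :: nat set set) w (\<tau> :: real) q.
      finite V \<and> V \<noteq> {} \<and> 0 < \<tau> \<and> balanced V s \<tau> w \<and>
      c * card V \<le> (\<Sum>g\<in>nsets V s. w g) \<and> \<tau> * card V \<le> real q \<and> real q \<le> \<delta> * card V \<longrightarrow>
      covered (independent_sets V s w) (binomial_sum (card V) q ^ s) ((1 - \<delta>) * card V))"
    using weighted_container[OF c, of s, where 'v = "nat set"] ..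
  note \<delta> = conjunct1[OF \<delta>'] conjunct1[OF conjunct2[OF \<delta>']]
    and container = conjunct2[OF conjunct2[OF \<delta>']]
  \<comment> \<open>The first entry makes the sampling ratio at most 1, the second makes
    \<open>q\<close> at most \<open>\<delta> * card E\<close>.\<close>
  define t\<^sub>0 where "t\<^sub>0 = max a ((b / \<delta>) powr (1 / (1 + \<eta>)))"
  define K where "K = real s * (1 + b * (1 + \<eta>) * (2 / \<eta>))"
  have t0: "a \<le> t\<^sub>0" "0 < t\<^sub>0" using a by (auto simp: t\<^sub>0_def)
  have K: "0 \<le> K" using b \<eta> by (simp add: K_def)
  have main: "\<exists>M. covered {I \<in> {I. free H ({1..n}, I)}. I \<subseteq> E} M ((1 - \<delta>) * real (card E)) \<and>
          real M \<le> exp (K * real (ex r n H) * (real (card E) / real (ex r n H)) powr (- (\<eta> / 2)))"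
    if n: "0 < n" and X0: "0 < ex r n H"
      and maximal: "\<And>m. m \<in> {1..n} \<Longrightarrow> real (ex r m H) * real n powr \<beta> \<le> real (ex r n H) * real m powr \<beta>"
      and big: "real r powr \<gamma> * real n powr \<beta> \<le> real (ex r n H)"
      and E: "E \<subseteq> nsets {1..n} r" and tE: "t\<^sub>0 * real (ex r n H) \<le> real (card E)" for n E
  proof -
    define X where "X = real (ex r n H)"
    define t where "t = real (card E) / X"
    have X: "0 < X" using X0 by (simp add: X_def)
    have cE: "real (card E) = t * X" using X by (simp add: t_def)
    have t: "t\<^sub>0 \<le> t" using tE X by (simp add: t_def X_def field_simps)
    then have t2: "2 \<le> t" "a \<le> t" using t0 a by auto
    have finE: "finite E" using E finite_imp_finite_nsets[of "{1..n}"] finite_subset by blast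
    have "E \<noteq> {}" using t2 X cE by auto
    then have "nsets {1..n} r \<noteq> {}" using E by blast
    then have rn: "r \<le> n" using nsets_eq_empty[of "{1..n}" r] by force
    have "card E \<le> n choose r"
      using card_mono[OF _ E] by (simp add: finite_imp_finite_nsets)
    also have "\<dots> \<le> n ^ r" using rn by (rule binomial_le_pow)
    finally have "real (card E) \<le> real n ^ r" by (metis of_nat_le_iff of_nat_power)
    also have "\<dots> = real n powr \<gamma> * real n powr \<beta>"
      using n by (simp add: \<gamma>_def powr_realpow flip: powr_add)
    finally have tX: "t * X \<le> real n powr \<gamma> * real n powr \<beta>" by (simp add: cE)
    \<comment> \<open>The ideal ratio \<open>m / n\<close>, determined by
      \<open>t * y powr \<gamma> = a\<close>. The actual ratio \<open>p\<close> lies between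
      \<open>y\<close> and \<open>2 * y\<close>.\<close>
    define y where "y = (a / t) powr (1 / \<gamma>)"
    have y0: "0 < y" using a t2 by (simp add: y_def)
    have "y \<le> 1 powr (1 / \<gamma>)" unfolding y_def using a t2 \<gamma> by (intro powr_mono2) auto
    then have y1: "y \<le> 1" by simp
    \<comment> \<open>Samples must have at least \<open>r\<close> vertices. As
      \<open>card E \<le> n ^ r\<close>, the lower bound on \<open>ex r n H\<close> limits
      \<open>t\<close> to \<open>(n / r) powr \<gamma>\<close>, so \<open>y\<close> is not too
      small.\<close>
    have yr: "real r \<le> real n * y"
    proof -
      have "t * (real r powr \<gamma> * real n powr \<beta>) \<le> t * X" using big t2 by (simp add: X_def)
      also note tX
      finally have "t * real r powr \<gamma> \<le> real n powr \<gamma>" using n by simp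
      also have "\<dots> \<le> a * real n powr \<gamma>" using a by (simp add: mult_le_cancel_right1)
      finally have "real r powr \<gamma> \<le> (a / t) * real n powr \<gamma>" using t2 by (simp add: field_simps)
      then have "(real r powr \<gamma>) powr (1 / \<gamma>) \<le> ((a / t) * real n powr \<gamma>) powr (1 / \<gamma>)"
        using \<gamma> by (intro powr_mono2) auto
      also have "\<dots> = y * (real n powr \<gamma>) powr (1 / \<gamma>)"
        unfolding y_def by (rule powr_mult)
      finally show ?thesis using \<gamma> n r by (simp add: powr_powr mult.commute)
    qed
    define m where "m = nat \<lceil>real n * y\<rceil>"
    have m1: "real n * y \<le> real m" unfolding m_def by (rule real_nat_ceiling_ge)
    have m2: "real m < real n * y + 1" unfolding m_def using y0 n by (simp add: of_nat_nat) linarith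
    have "real m < real n + 1" using m2 y1 n by (smt (verit) mult_le_cancel_left2 of_nat_0_less_iff)
    then have mn: "m \<le> n" by linarith
    have rm: "r \<le> m" using yr m1 by linarith
    have m0: "0 < m" using rm r by linarith
    define p where "p = real m / real n"
    have p: "0 < p" "p \<le> 1" using m0 mn n by (auto simp: p_def)
    have py: "y \<le> p" using m1 n by (simp add: p_def field_simps)
    have "1 \<le> real n * y" using yr r by linarith
    then have "real m \<le> 2 * (real n * y)" using m2 by linarith
    then have py2: "p \<le> 2 * y" using n by (simp add: p_def field_simps)
    have "y powr \<gamma> \<le> p powr \<gamma>" using py y0 \<gamma> by (intro powr_mono2) auto
    then have p\<gamma>: "a / t \<le> p powr \<gamma>" using \<gamma> a t2 by (simp add: y_def powr_powr)
    define Z where "Z = real ((n - r) choose (m - r))"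
    have Z: "0 \<le> Z" by (simp add: Z_def)
    have exm: "real (ex r m H) \<le> X * p powr \<beta>"
    proof -
      have "real (ex r m H) * real n powr \<beta> \<le> X * real m powr \<beta>"
        unfolding X_def by (rule maximal) (use m0 mn in auto)
      then show ?thesis using n by (simp add: p_def powr_divide field_simps)
    qed
    have many: "2 * real (ex r m H) * real (n choose m) \<le> real (card E) * Z"
    proof -
      have "a \<le> t * p powr \<gamma>" using p\<gamma> t2 by (simp add: field_simps)
      then have "a * (p powr \<beta> * real (n choose m)) \<le> t * p powr \<gamma> * (p powr \<beta> * real (n choose m))"
        by (rule mult_right_mono) simp
      also have "\<dots> = t * (real (n choose m) * p ^ r)"
      proof -
        have "p powr \<gamma> * p powr \<beta> = p ^ r"
          using p by (simp add: \<gamma>_def powr_realpow flip: powr_add)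
        then have "t * (p powr \<gamma> * p powr \<beta>) * real (n choose m) = t * p ^ r * real (n choose m)" by simp
        then show ?thesis by (simp only: mult_ac)
      qed
      also have "\<dots> \<le> t * (Z * real r ^ r)"
        using binomial_shift_ge[OF rm m0 mn] t2 unfolding Z_def p_def by (intro mult_left_mono) auto
      finally have "2 * (p powr \<beta> * real (n choose m)) * real r ^ r \<le> t * Z * real r ^ r"
        by (simp add: a_def mult_ac)
      then have *: "2 * (p powr \<beta> * real (n choose m)) \<le> t * Z"
        by (rule mult_right_le_imp_le) (use rr in linarith)
      have "2 * real (ex r m H) * real (n choose m) \<le> 2 * (X * p powr \<beta>) * real (n choose m)"
        using exm by (intro mult_right_mono) auto
      also have "\<dots> = X * (2 * (p powr \<beta> * real (n choose m)))" by simp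
      also have "\<dots> \<le> X * (t * Z)" using * X by (intro mult_left_mono) auto
      finally show ?thesis by (simp add: cE mult_ac)
    qed
    \<comment> \<open>Combined with \<open>p ^ r \<le> \<tau>\<close>, this gives
      \<open>\<tau> * card E \<ge> 1\<close>, so that rounding up to \<open>q\<close> at most
      doubles the value.\<close>
    have Ep: "1 \<le> real (card E) * p ^ r"
    proof -
      have "real (card {R \<in> nsets {1..n} m. {1..r} \<subseteq> R}) \<le> real (n choose m) * p ^ r"
        using card_nsets_supersets_le[of "{1..n}" "{1..r}" m] rn mn by (simp add: p_def)
      then have Zle: "Z \<le> real (n choose m) * p ^ r"
        using card_nsets_supersets[of "{1..n}" "{1..r}" m] rn rm by (simp add: Z_def)
      have "1 * real (n choose m) \<le> 2 * real (ex r m H) * real (n choose m)"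
        using ex_pos[OF H rm] by (intro mult_right_mono) auto
      also note many
      also have "real (card E) * Z \<le> real (card E) * (real (n choose m) * p ^ r)"
        using Zle by (intro mult_left_mono) auto
      finally have "1 * real (n choose m) \<le> (real (card E) * p ^ r) * real (n choose m)" by (simp add: mult_ac)
      then show ?thesis using mn by (simp only: mult_le_cancel_right_pos of_nat_0_less_iff zero_less_binomial)
    qed
    define \<tau> where "\<tau> = p powr \<mu>"
    have \<tau>: "0 < \<tau>" using p by (simp add: \<tau>_def)
    define q where "q = nat \<lceil>\<tau> * real (card E)\<rceil>"
    have q1: "\<tau> * real (card E) \<le> real q" unfolding q_def by (rule real_nat_ceiling_ge)
    have "p ^ r \<le> \<tau>"
      using p \<mu> unfolding \<tau>_def by (subst powr_realpow[symmetric]) (auto intro: powr_mono')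
    then have "1 \<le> \<tau> * real (card E)"
      using Ep by (smt (verit) mult.commute mult_left_mono of_nat_0_le_iff)
    then have q2: "real q \<le> 2 * \<tau> * real (card E)"
      unfolding q_def by linarith
    have "\<tau> \<le> (2 * y) powr \<mu>" unfolding \<tau>_def using py2 p \<mu> by (intro powr_mono2) auto
    also have "\<dots> = 2 powr \<mu> * a powr (\<mu> / \<gamma>) * t powr (- (1 + \<eta>))"
      using y0 a t2 by (simp add: y_def powr_mult powr_powr powr_divide powr_minus \<eta>_def field_simps)
    finally have "2 * \<tau> \<le> b * t powr (- (1 + \<eta>))" by (simp add: b_def)
    then have "2 * \<tau> * real (card E) \<le> b * t powr (- (1 + \<eta>)) * real (card E)"
      by (intro mult_right_mono) auto
    then have q3: "real q \<le> b * t powr (- (1 + \<eta>)) * real (card E)" using q2 by linarith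
    have q4: "real q \<le> \<delta> * real (card E)"
    proof -
      have "((b / \<delta>) powr (1 / (1 + \<eta>))) powr (1 + \<eta>) \<le> t powr (1 + \<eta>)"
        using t \<eta> by (intro powr_mono2) (auto simp: t\<^sub>0_def)
      then have "b / \<delta> \<le> t powr (1 + \<eta>)" using \<eta> b \<delta> by (simp add: powr_powr)
      moreover have "0 < t powr (1 + \<eta>)" using t2 by simp
      ultimately have "b * t powr (- (1 + \<eta>)) \<le> \<delta>"
        using \<delta> unfolding powr_minus[of t "1 + \<eta>"] by (simp add: field_simps)
      then have "b * t powr (- (1 + \<eta>)) * real (card E) \<le> \<delta> * real (card E)"
        by (intro mult_right_mono) auto
      then show ?thesis using q3 by linarith
    qed
    have "edges H \<noteq> {}" using s by (auto simp: s_def)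
    from supersaturation[OF H(1) this d(1) E rm m0 mn many[unfolded Z_def]]
    obtain w where w: "balanced E s \<tau> w" "c * real (card E) \<le> (\<Sum>T\<in>nsets E s. w T)"
      "\<forall>I. I \<subseteq> E \<longrightarrow> free H ({1..n}, I) \<longrightarrow> I \<in> independent_sets E s w"
      unfolding s_def[symmetric] p_def[symmetric] \<mu>_def[symmetric] \<tau>_def[symmetric] c_def[symmetric]
      by (elim exE conjE)
    have "covered (independent_sets E s w) (binomial_sum (card E) q ^ s) ((1 - \<delta>) * card E)"
      by (rule container[rule_format]) (use finE \<open>E \<noteq> {}\<close> \<tau> w(1,2) q1 q4 in simp)
    then have "covered {I \<in> {I. free H ({1..n}, I)}. I \<subseteq> E} (binomial_sum (card E) q ^ s) ((1 - \<delta>) * card E)"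
      by (rule covered_mono) (use w(3) in auto)
    moreover have "real (binomial_sum (card E) q ^ s) \<le> exp (K * X * t powr (- (\<eta> / 2)))"
    proof -
      \<comment> \<open>This \<open>x\<close> is a bound for \<open>q / card E\<close> up to the
        factor \<open>b\<close>, so both terms of \<open>ln_binomial_sum_le\<close> are of order
        \<open>X * t powr (- \<eta>)\<close> apart from a factor \<open>ln t\<close>.\<close>
      define x where "x = t powr (- (1 + \<eta>))"
      have x: "0 < x" "x \<le> 1"
        using t2 \<eta> powr_mono[of "- (1 + \<eta>)" 0 t] by (auto simp: x_def)
      have xE: "real (card E) * x = X * t powr (- \<eta>)"
      proof -
        have "t * x = t powr 1 * t powr (- (1 + \<eta>))" using t2 by (simp add: x_def)
        also have "\<dots> = t powr (1 + - (1 + \<eta>))" by (rule powr_add[symmetric])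
        also have "1 + - (1 + \<eta>) = - \<eta>" by simp
        finally have "X * (t * x) = X * t powr (- \<eta>)" by simp
        then show ?thesis by (simp add: cE mult_ac)
      qed
      have lnx: "ln (1 / x) = (1 + \<eta>) * ln t" using t2 by (simp add: x_def ln_div ln_powr algebra_simps)
      \<comment> \<open>Half of the exponent \<eta> is spent on absorbing \<open>ln t\<close>; the
        other half is the \<theta> of the conclusion, and \<open>2 / \<eta>\<close> goes into
        \<open>K\<close>.\<close>
      have lnt: "ln t \<le> 2 / \<eta> * t powr (\<eta> / 2)"
        using ln_powr_bound[of t "\<eta> / 2"] t2 \<eta> by (simp add: mult.commute)
      have lnt0: "0 \<le> ln t" using t2 by simp
      have "ln (real (binomial_sum (card E) q)) \<le> real (card E) * x + real q * ln (1 / x)"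
        using x by (rule ln_binomial_sum_le)
      also have "\<dots> \<le> X * t powr (- \<eta>) + (b * (X * t powr (- \<eta>))) * ((1 + \<eta>) * (2 / \<eta> * t powr (\<eta> / 2)))"
      proof (rule add_mono)
        have "real q \<le> b * (X * t powr (- \<eta>))" using q3 xE unfolding x_def by (simp add: mult_ac)
        moreover have "ln (1 / x) \<le> (1 + \<eta>) * (2 / \<eta> * t powr (\<eta> / 2))"
          unfolding lnx using lnt \<eta> by (intro mult_left_mono) auto
        ultimately show "real q * ln (1 / x) \<le> (b * (X * t powr (- \<eta>))) * ((1 + \<eta>) * (2 / \<eta> * t powr (\<eta> / 2)))"
          using b X lnt0 \<eta> by (intro mult_mono) (auto simp: lnx)
      qed (simp add: xE)
      also have "\<dots> \<le> (1 + b * (1 + \<eta>) * (2 / \<eta>)) * (X * t powr (- (\<eta> / 2)))"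
      proof -
        have "t powr (- \<eta>) * t powr (\<eta> / 2) = t powr (- (\<eta> / 2))" by (simp flip: powr_add)
        then have "(b * (X * t powr (- \<eta>))) * ((1 + \<eta>) * (2 / \<eta> * t powr (\<eta> / 2)))
            = b * (1 + \<eta>) * (2 / \<eta>) * (X * t powr (- (\<eta> / 2)))" by (simp add: mult_ac)
        moreover have "t powr (- \<eta>) \<le> t powr (- (\<eta> / 2))" using t2 \<eta> by (intro powr_mono) auto
        then have "X * t powr (- \<eta>) \<le> X * t powr (- (\<eta> / 2))" using X by (intro mult_left_mono) auto
        ultimately show ?thesis by (simp only: distrib_right mult_1_left add_right_mono)
      qed
      finally have ln_le: "ln (real (binomial_sum (card E) q)) \<le> (1 + b * (1 + \<eta>) * (2 / \<eta>)) * (X * t powr (- (\<eta> / 2)))" .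
      have pos: "0 < real (binomial_sum (card E) q)" using binomial_sum_ge_1[of "card E" q] by simp
      have "real s * ln (real (binomial_sum (card E) q)) \<le> K * X * t powr (- (\<eta> / 2))"
        using mult_left_mono[OF ln_le, of "real s"] by (simp add: K_def mult_ac)
      then have "exp (real s * ln (real (binomial_sum (card E) q))) \<le> exp (K * X * t powr (- (\<eta> / 2)))"
        by simp
      then show ?thesis using pos by (simp add: exp_of_nat_mult)
    qed
    ultimately show ?thesis unfolding X_def[symmetric] t_def[symmetric] by blast
  qed
  show ?thesis
    by (rule exI[of _ t\<^sub>0], rule exI[of _ \<delta>], rule exI[of _ "\<eta> / 2"], rule exI[of _ K],
        intro conjI allI impI; (elim conjE)?)
      (rule t0 \<delta> K half_gt_zero[OF \<eta>] main | assumption | erule (1) bspec)+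
qed

section \<open>Infinitely many good orders\<close>

text \<open>Two distinct edges span \<open>r + k\<close> vertices with
  \<open>1 \<le> k \<le> r\<close>, so the density is at least \<open>1 / k\<close>. The bound
  \<open>1 / density r H \<le> r\<close> later gives \<open>p ^ r \<le> \<tau>\<close>.\<close>

lemma density_bounds:
  assumes H: "uniform r H" "2 \<le> card (edges H)"
  shows "1 \<le> r" "0 < density r H" "1 / density r H \<le> real r"
proof -
  obtain J where J: "J \<subseteq> edges H" "card J = 2"
    using obtain_subset_with_card_n[OF H(2)] by metis
  then obtain e f where ef: "J = {e, f}" by (auto simp: card_2_iff)
  have "J \<noteq> {}" using J by auto
  note bound = card_edges_le_density[OF H(1) J(1) this]
  define k where "k = card (\<Union>J) - r"
  have "card e = r" "card f = r" using ef J(1) edge_subset_verts(3)[OF H(1)] by auto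
  then have "card (\<Union>J) \<le> r + r" using ef card_Un_le[of e f] by simp
  then have k: "k \<le> r" by (simp add: k_def)
  have dk: "1 \<le> density r H * real k" using bound(2) J(2) unfolding k_def[symmetric] by simp
  then have k0: "0 < k" by (cases k) auto
  show d: "0 < density r H"
  proof (rule ccontr)
    assume "\<not> 0 < density r H"
    then have "density r H * real k \<le> 0" by (simp add: mult_le_0_iff)
    then show False using dk by linarith
  qed
  have "1 / density r H \<le> real k" using dk d by (simp add: field_simps)
  then show "1 / density r H \<le> real r" using k by linarith
  show "1 \<le> r" using k k0 by linarith
qed

lemma inj_on_extend_card:
  assumes "finite A" "finite B" "a \<subseteq> A" "b \<subseteq> B" "card a = card b" "card A \<le> card B"
  shows "\<exists>f. inj_on f A \<and> f ` A \<subseteq> B \<and> f ` a = b"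
proof -
  have fin: "finite a" "finite b" using assms finite_subset by auto
  obtain g where g: "bij_betw g a b" using finite_same_card_bij[OF fin assms(5)] by blast
  have "card (A - a) \<le> card (B - b)" using assms fin by (simp add: card_Diff_subset)
  then obtain h where h: "h ` (A - a) \<subseteq> B - b" "inj_on h (A - a)"
    using card_le_inj[of "A - a" "B - b"] assms by blast
  define f where "f x = (if x \<in> a then g x else h x)" for x
  have fa: "f ` a = b" "inj_on f a"
    using g by (auto simp: f_def bij_betw_def inj_on_def)
  have fA: "f ` (A - a) \<subseteq> B - b" "inj_on f (A - a)"
    using h by (auto simp: f_def inj_on_def)
  have "inj_on f (a \<union> (A - a))"
    using fa fA by (subst inj_on_Un) blast
  moreover have "a \<union> (A - a) = A" using assms(3) by blast
  ultimately have "inj_on f A" by simp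
  moreover have "f ` A \<subseteq> B" using fa(1) fA(1) assms(4) by blast
  ultimately show ?thesis using fa(1) by blast
qed

text \<open>Any edge of \<open>E\<close> already yields a copy: the edge of \<open>H\<close>, if
  there is one, is mapped onto it, and the remaining vertices of \<open>H\<close> fit because
  \<open>n\<close> is at least \<open>card (verts H)\<close>.\<close>

lemma free_imp_edgeless:
  fixes E :: "nat set set"
  assumes H: "uniform r H" "card (edges H) \<le> 1"
    and n: "card (verts H) \<le> n" and E: "E \<subseteq> nsets {1..n} r" and fr: "free H ({1..n}, E)"
  shows "E = {}"
proof (rule ccontr)
  assume "E \<noteq> {}"
  then obtain g where g: "g \<in> E" by blast
  then have g': "g \<subseteq> {1..n}" "card g = r" using E by (auto simp: nsets_def)
  have fin: "finite (verts H)" "finite (edges H)" using uniform_finite[OF H(1)] by auto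
  have cV: "card (verts H) \<le> card {1..n}" using n by simp
  have "\<exists>f. inj_on f (verts H) \<and> f ` verts H \<subseteq> {1..n} \<and> (\<forall>e\<in>edges H. f ` e \<in> E)"
  proof (cases "edges H = {}")
    case True
    then show ?thesis
      using inj_on_extend_card[of "verts H" "{1..n}" "{}" "{}"] fin(1) cV by auto
  next
    case False
    then have "card (edges H) = 1" using H(2) fin(2) by (simp add: le_Suc_eq)
    then obtain h where h: "edges H = {h}" by (auto simp: card_1_singleton_iff)
    then have "h \<subseteq> verts H" "card h = card g" using edge_subset_verts[OF H(1), of h] g'(2) by auto
    then obtain f where "inj_on f (verts H)" "f ` verts H \<subseteq> {1..n}" "f ` h = g"
      using inj_on_extend_card[of "verts H" "{1..n}" h g] fin(1) cV g'(1) by auto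
    then show ?thesis using h g by auto
  qed
  then have "copies H {1..n} E \<noteq> {}" by (auto simp: copies_def)
  then show False using fr free_iff_copies[OF H(1), of "{1..n}" E] by simp
qed

lemma free_graphs_conv:
  "free_graphs r n H = Pair {1..n} ` {I \<in> {I. free H ({1..n}, I)}. I \<subseteq> nsets {1..n} r}"
  by (auto simp: free_graphs_def uniform_def image_iff)

text \<open>The first index at which \<open>a\<close> exceeds its maximum over \<open>{..N}\<close>
  is a record beyond \<open>N\<close>.\<close>

lemma exists_record:
  fixes a :: "nat \<Rightarrow> real"
  assumes "filterlim a at_top sequentially"
  shows "\<exists>n>N. \<forall>m\<le>n. a m \<le> a n"
proof -
  define M where "M = Max (a ` {..N})"
  have M: "a m \<le> M" if "m \<le> N" for m using that by (simp add: M_def)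
  have "eventually (\<lambda>n. M < a n) sequentially"
    using assms by (simp add: filterlim_at_top_dense)
  then obtain n where "M < a n" by (auto simp: eventually_sequentially)
  define l where "l = (LEAST n. M < a n)"
  have l: "M < a l" unfolding l_def by (rule LeastI) fact
  then have "N < l" using M[of l] by (metis not_le)
  moreover have "a m \<le> a l" if "m \<le> l" for m
  proof (cases "m = l")
    case False
    then have "\<not> M < a m" using that not_less_Least[of m "\<lambda>n. M < a n"] by (simp add: l_def)
    then show ?thesis using l by linarith
  qed simp
  ultimately show ?thesis by blast
qed

theorem theorem1p9:
  fixes H :: "'a hypergraph" and r :: nat and \<epsilon> :: real
  assumes "uniform r H"
    and "\<epsilon> > 0"
    and "\<forall>\<^sub>F n in sequentially.
           real (ex r n H) \<ge> \<epsilon> * real n powr (real r - 1 / density r H + \<epsilon>)"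
  shows "\<exists>C :: real. \<exists>s :: nat \<Rightarrow> nat. strict_mono s \<and>
           (\<forall>k. s k > 0 \<and>
              real (card (free_graphs r (s k) H)) \<le> 2 powr (C * real (ex r (s k) H)))"
proof (cases "2 \<le> card (edges H)")
  case False
  \<comment> \<open>With at most one edge \<open>density r H\<close> need not be positive. From
    \<open>card (verts H)\<close> vertices on only the edgeless hypergraph can be
    \<open>H\<close>-free, so \<open>C = 0\<close> works.\<close>
  define s where "s k = card (verts H) + k + 1" for k
  have "real (card (free_graphs r (s k) H)) \<le> 2 powr (0 * real (ex r (s k) H))" for k
  proof -
    have "free_graphs r (s k) H \<subseteq> {({1..s k}, {})}"
      using free_imp_edgeless[OF assms(1), of "s k"] False by (auto simp: free_graphs_conv s_def)
    then have "card (free_graphs r (s k) H) \<le> card {({1..s k}, {} :: nat set set)}"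
      by (intro card_mono) auto
    then show ?thesis by simp
  qed
  moreover have "strict_mono s" by (simp add: strict_mono_def s_def)
  ultimately show ?thesis by (intro exI[of _ 0] exI[of _ s]) (simp add: s_def)
next
  case True
  note H = assms(1) True
  note d = density_bounds[OF H]
  define \<mu> where "\<mu> = 1 / density r H"
  \<comment> \<open>The minimum makes \<open>r - \<beta>\<close> positive without an upper bound on \<open>\<epsilon>\<close>.\<close>
  define \<epsilon>' where "\<epsilon>' = min \<epsilon> \<mu>"
  \<comment> \<open>Half of \<open>\<epsilon>'\<close> serves both needs:
    \<open>r - \<beta> = \<mu> - \<epsilon>' / 2\<close> is strictly below \<mu>, and
    \<open>a n\<close> still grows at least like
    \<open>n powr (\<epsilon> - \<epsilon>' / 2)\<close>.\<close>
  define \<beta> where "\<beta> = real r - \<mu> + \<epsilon>' / 2"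
  define a where "a n = real (ex r n H) / real n powr \<beta>" for n
  have \<epsilon>': "0 < \<epsilon>'" "\<epsilon>' \<le> \<epsilon>" "\<epsilon>' \<le> \<mu>" using assms(2) d by (auto simp: \<epsilon>'_def \<mu>_def)
  have a: "filterlim a at_top sequentially"
  proof (rule filterlim_at_top_mono)
    have "filterlim (\<lambda>n. exp ((\<epsilon> - \<epsilon>' / 2) * ln (real n))) at_top sequentially"
      using \<epsilon>'
      by (intro filterlim_compose[OF exp_at_top] filterlim_tendsto_pos_mult_at_top[OF tendsto_const]
          filterlim_compose[OF ln_at_top] filterlim_real_sequentially) auto
    moreover have "eventually (\<lambda>n. exp ((\<epsilon> - \<epsilon>' / 2) * ln (real n)) = real n powr (\<epsilon> - \<epsilon>' / 2)) sequentially"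
      using eventually_gt_at_top[of 0] by eventually_elim (simp add: powr_def)
    ultimately have "filterlim (\<lambda>n. real n powr (\<epsilon> - \<epsilon>' / 2)) at_top sequentially"
      using filterlim_cong[OF refl refl] by force
    then show "filterlim (\<lambda>n. \<epsilon> * real n powr (\<epsilon> - \<epsilon>' / 2)) at_top sequentially"
      using assms(2) by (intro filterlim_tendsto_pos_mult_at_top[OF tendsto_const])
    show "eventually (\<lambda>n. \<epsilon> * real n powr (\<epsilon> - \<epsilon>' / 2) \<le> a n) sequentially"
      using assms(3) eventually_gt_at_top[of 0]
    proof eventually_elim
      case (elim n)
      have "real n powr (\<epsilon> - \<epsilon>' / 2) * real n powr \<beta> = real n powr (real r - 1 / density r H + \<epsilon>)"
        by (simp add: \<beta>_def \<mu>_def add.commute flip: powr_add)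
      then have "\<epsilon> * real n powr (\<epsilon> - \<epsilon>' / 2) * real n powr \<beta> \<le> real (ex r n H)"
        using elim(1) by (simp only: mult.assoc)
      moreover have "0 < real n powr \<beta>" using elim(2) by simp
      ultimately show ?case by (simp only: a_def pos_le_divide_eq)
    qed
  qed
  have \<gamma>: "0 < real r - \<beta>" "real r - \<beta> < 1 / density r H"
    using \<epsilon>' by (auto simp: \<beta>_def \<mu>_def)
  from supersaturated_container[OF H d(2,3,1) \<gamma>]
  obtain t\<^sub>0 \<delta> \<theta> K :: real where c: "0 < t\<^sub>0" "0 < \<delta>" "\<delta> < 1" "0 < \<theta>" "0 \<le> K"
    and step: "\<forall>n E. 0 < n \<and> 0 < ex r n H \<and>
       (\<forall>m\<in>{1..n}. real (ex r m H) * real n powr \<beta> \<le> real (ex r n H) * real m powr \<beta>) \<and>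
       real r powr (real r - \<beta>) * real n powr \<beta> \<le> real (ex r n H) \<and>
       E \<subseteq> nsets {1..n} r \<and> t\<^sub>0 * real (ex r n H) \<le> real (card E) \<longrightarrow>
       (\<exists>M. covered {I \<in> {I. free H ({1..n}, I)}. I \<subseteq> E} M ((1 - \<delta>) * real (card E)) \<and>
          real M \<le> exp (K * real (ex r n H) * (real (card E) / real (ex r n H)) powr (- \<theta>)))"
    by (elim exE conjE)
  define C where "C = t\<^sub>0 * ln 2 + K / ((1 - \<delta>) powr (- \<theta>) - 1) * ((1 - \<delta>) * t\<^sub>0) powr (- \<theta>)"
  define S where "S = {n. 0 < n \<and> real (card (free_graphs r n H)) \<le> 2 powr (C / ln 2 * real (ex r n H))}"
  have "\<exists>n>N. n \<in> S" for N
  proof -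
    have "eventually (\<lambda>n. real r powr (real r - \<beta>) \<le> a n) sequentially"
      using a by (simp add: filterlim_at_top)
    then obtain N' where N': "\<And>n. n \<ge> N' \<Longrightarrow> real r powr (real r - \<beta>) \<le> a n"
      by (auto simp: eventually_sequentially)
    \<comment> \<open>Being a record gives the bounds on \<open>ex r m H\<close> for
      \<open>m \<le> n\<close>, and lying beyond \<open>N'\<close> gives the lower bound on
      \<open>ex r n H\<close> that makes samples large enough.\<close>
    obtain n where n: "max N N' < n" "\<And>m. m \<le> n \<Longrightarrow> a m \<le> a n"
      using exists_record[OF a, of "max N N'"] by blast
    have n0: "0 < n" using n(1) by simp
    have npos: "0 < real n powr \<beta>" using n0 by simp
    have big: "real r powr (real r - \<beta>) * real n powr \<beta> \<le> real (ex r n H)"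
      using N'[of n] n(1) npos by (simp add: a_def field_simps)
    moreover have "0 < real r powr (real r - \<beta>) * real n powr \<beta>" using d(1) npos by simp
    ultimately have X: "0 < real (ex r n H)" by linarith
    have maximal: "\<forall>m\<in>{1..n}. real (ex r m H) * real n powr \<beta> \<le> real (ex r n H) * real m powr \<beta>"
    proof
      fix m assume m: "m \<in> {1..n}"
      then have "0 < real m powr \<beta>" by simp
      then show "real (ex r m H) * real n powr \<beta> \<le> real (ex r n H) * real m powr \<beta>"
        using n(2)[of m] m npos by (simp add: a_def field_simps)
    qed
    have "real (card {I \<in> {I. free H ({1..n}, I)}. I \<subseteq> nsets {1..n} r}) \<le> exp (C * real (ex r n H))"
      unfolding C_def
    proof (rule iterated_containers[OF X c])
      show "finite (nsets {1..n} r)" by (simp add: finite_imp_finite_nsets)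
      fix D assume "D \<subseteq> nsets {1..n} r" "t\<^sub>0 * real (ex r n H) \<le> real (card D)"
      then show "\<exists>M. covered {I \<in> {I. free H ({1..n}, I)}. I \<subseteq> D} M ((1 - \<delta>) * real (card D)) \<and>
          real M \<le> exp (K * real (ex r n H) * (real (card D) / real (ex r n H)) powr (- \<theta>))"
        using n0 X maximal big by (intro step[rule_format] conjI) simp_all
    qed
    also have "exp (C * real (ex r n H)) = 2 powr (C / ln 2 * real (ex r n H))"
      by (simp add: powr_def)
    finally have "n \<in> S"
      using n0 by (simp add: S_def free_graphs_conv card_image inj_on_def)
    then show ?thesis using n(1) by (intro exI[of _ n]) simp
  qed
  then have inf: "infinite S" unfolding infinite_nat_iff_unbounded by blast
  show ?thesis
  proof (intro exI conjI allI)
    show "strict_mono (enumerate S)" using inf by (rule strict_mono_enumerate)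
    have "enumerate S k \<in> S" for k using inf by (rule enumerate_in_set)
    then show "0 < enumerate S k"
      "real (card (free_graphs r (enumerate S k) H)) \<le> 2 powr (C / ln 2 * real (ex r (enumerate S k) H))" for k
      unfolding S_def by auto
  qed
qed

end
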